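(* Let $G$ be a real, non-trivial, connected, unipotent group which acts effectively and polynomially on a connected smooth closed algebraic variety $X\subset\mathbb{R}^n$. Then the set $\mathrm{Fix}(G)$ of fixed points of this action is $\mathbb{R}$-uniruled.
   Context: A real unipotent group is a unipotent real linear algebraic group. The action is polynomial if the action map $G\times X\to X$ is a polynomial map. $\mathrm{Fix}(G)=\{x\in X: gx=x \text{ for all } g\in G\}$. A real polynomially parametric curve of degree at most $d$ in a semialgebraic set $Z\subset\mathbb{R}^n$ is the image of a non-constant real polynomial map $\mathbb{R}\to Z$ of degree at most $d$ (the degree of a polynomial map is the maximum of the degrees of its components). A closed semialgebraic set $Z\subset\mathbb{R}^n$ has degree of $\mathbb{R}$-uniruledness at most $d$ if for every $x\in Z$ there is a real polynomially parametric curve $l_x\subset Z$ of degree at most $d$ passing through $x$; $Z$ is $\mathbb{R}$-uniruled if this holds for some $d$. By convention the empty set is $\mathbb{R}$-uniruled. *)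

theory Defs
  imports "HOL-Analysis.Analysis" "HOL-Computational_Algebra.Polynomial" "HOL-Algebra.Group_Action"
begin

section \<open>Real algebraic and semialgebraic sets\<close>

definition algebraic_set :: "'a::real_normed_vector set \<Rightarrow> bool" where
  "algebraic_set X \<longleftrightarrow>
     (\<exists>P. finite P \<and> (\<forall>p\<in>P. real_polynomial_function p) \<and> X = {x. \<forall>p\<in>P. p x = 0})"

text \<open>The Boolean algebra of sets generated by the strict polynomial inequalities.\<close>

inductive semialgebraic :: "'a::real_normed_vector set \<Rightarrow> bool" where
  pos: "real_polynomial_function p \<Longrightarrow> semialgebraic {x. p x > 0}"
| compl: "semialgebraic A \<Longrightarrow> semialgebraic (- A)"
| inter: "semialgebraic A \<Longrightarrow> semialgebraic B \<Longrightarrow> semialgebraic (A \<inter> B)"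

text \<open>
  Nonsingular points of dimension \<open>d\<close>: near \<open>x\<close> the set \<open>X\<close> is cut out by \<open>n - d\<close> polynomials
  which vanish on the whole of \<open>X\<close> and have linearly independent gradients at \<open>x\<close>
  (Akbulut-King, Topology of Real Algebraic Sets; Bochnak-Coste-Roy, Section 3.3). The condition
  that the polynomials vanish on all of \<open>X\<close> is what makes this an algebraic notion of
  smoothness, stronger than being a submanifold.
\<close>

definition nonsingular_at :: "nat \<Rightarrow> (real^'n) set \<Rightarrow> real^'n \<Rightarrow> bool" where
  "nonsingular_at d X x \<longleftrightarrow>
     (\<exists>P U D. finite P \<and> card P + d = CARD('n) \<and>
        (\<forall>p\<in>P. real_polynomial_function p \<and> (\<forall>y\<in>X. p y = 0)) \<and>
        open U \<and> x \<in> U \<and> X \<inter> U = {y\<in>U. \<forall>p\<in>P. p y = 0} \<and>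
        (\<forall>p\<in>P. GDERIV p x :> D p) \<and> inj_on D P \<and> independent (D ` P))"

definition smooth_algebraic_set :: "(real^'n) set \<Rightarrow> bool" where
  "smooth_algebraic_set X \<longleftrightarrow>
     algebraic_set X \<and> (\<exists>d. \<forall>x\<in>X. nonsingular_at d X x)"


section \<open>Uniruledness over the reals\<close>

definition poly_map :: "real poly ^ 'n \<Rightarrow> real \<Rightarrow> real ^ 'n" where
  "poly_map p t = (\<chi> i. poly (p $ i) t)"

definition polynomially_parametric_curve :: "nat \<Rightarrow> (real^'n) set \<Rightarrow> (real^'n) set \<Rightarrow> bool" where
  "polynomially_parametric_curve d Z l \<longleftrightarrow>
     (\<exists>p. (\<forall>i. degree (p $ i) \<le> d) \<and> \<not> poly_map p constant_on UNIV \<and>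
          l = range (poly_map p) \<and> l \<subseteq> Z)"

definition R_uniruled_of_degree_le :: "nat \<Rightarrow> (real^'n) set \<Rightarrow> bool" where
  "R_uniruled_of_degree_le d Z \<longleftrightarrow>
     closed Z \<and> semialgebraic Z \<and>
     (\<forall>x\<in>Z. \<exists>l. polynomially_parametric_curve d Z l \<and> x \<in> l)"

definition R_uniruled :: "(real^'n) set \<Rightarrow> bool" where
  "R_uniruled Z \<longleftrightarrow> (\<exists>d. R_uniruled_of_degree_le d Z)"


section \<open>Real linear algebraic groups and polynomial actions\<close>

definition general_linear_group :: "(real^'m^'m) monoid" where
  "general_linear_group = \<lparr>carrier = {A. invertible A}, mult = (**), one = mat 1\<rparr>"

text \<open>
  A real linear algebraic group is a subgroup \<open>G\<close> of a general linear group which is the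
  trace on that group of an algebraic set of matrices.
\<close>

definition linear_algebraic_group :: "(real^'m^'m) set \<Rightarrow> bool" where
  "linear_algebraic_group G \<longleftrightarrow>
     subgroup G general_linear_group \<and>
     (\<exists>V. algebraic_set V \<and> G = V \<inter> carrier general_linear_group)"

text \<open>
  The powers of \<open>A - 1\<close> are written with \<open>(**)\<close> because \<open>(^)\<close> on \<open>real^'m^'m\<close> is the
  entrywise power.
\<close>

definition unipotent_matrix :: "real^'m^'m \<Rightarrow> bool" where
  "unipotent_matrix A \<longleftrightarrow> (\<exists>k. (((**) (A - mat 1)) ^^ k) (mat 1) = 0)"

definition unipotent_group :: "(real^'m^'m) set \<Rightarrow> bool" where
  "unipotent_group G \<longleftrightarrow> linear_algebraic_group G \<and> (\<forall>A\<in>G. unipotent_matrix A)"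

text \<open>
  The maps \<open>\<phi> g\<close> of a \<^locale>\<open>group_action\<close> on \<open>X\<close> are fixed to be \<open>undefined\<close> outside \<open>X\<close>, so
  polynomiality is asked of the restriction to \<open>G \<times> X\<close> only. No denominators (powers of the
  determinant) are needed, as unipotent matrices have determinant 1.
\<close>

definition polynomial_action ::
    "(real^'m^'m) set \<Rightarrow> (real^'n) set \<Rightarrow> (real^'m^'m \<Rightarrow> real^'n \<Rightarrow> real^'n) \<Rightarrow> bool" where
  "polynomial_action G X \<phi> \<longleftrightarrow>
     group_action (general_linear_group\<lparr>carrier := G\<rparr>) X \<phi> \<and>
     (\<exists>F. polynomial_function F \<and> (\<forall>g\<in>G. \<forall>x\<in>X. \<phi> g x = F (g, x)))"

definition fixed_points ::
    "(real^'m^'m) set \<Rightarrow> (real^'n) set \<Rightarrow> (real^'m^'m \<Rightarrow> real^'n \<Rightarrow> real^'n) \<Rightarrow> (real^'n) set" where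
  "fixed_points G X \<phi> = {x\<in>X. \<forall>g\<in>G. \<phi> g x = x}"

end

theory Submission
  imports Defs "HOL-Complex_Analysis.Conformal_Mappings"
begin

text \<open>
  Let \<open>a\<close> be a fixed point. By the identity theorem on \<open>X\<close> there are non-fixed points
  \<open>x\<^sub>i \<rightarrow> a\<close>. The group \<open>G\<close> is exhausted by balls \<open>B R\<close>, graded by the powers of the augmentation
  ideal, which is nilpotent because \<open>G\<close> is unipotent. Choose \<open>R\<^sub>i\<close> such that \<open>B R\<^sub>i\<close> moves \<open>x\<^sub>i\<close> by at most
  1 but some \<open>h\<^sub>i\<close> in \<open>B (2 R\<^sub>i)\<close> moves it by more; then \<open>R\<^sub>i \<rightarrow> \<infinity>\<close>. The polynomial curves
  \<open>u \<mapsto> h\<^sub>i\<^sup>u x\<^sub>i\<close> have bounded degree and are bounded on a fixed interval, hence subconverge to a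
  non-constant polynomial curve \<open>p\<close> through \<open>a\<close>. For \<open>g\<close> in \<open>G\<close> the curve \<open>s \<mapsto> g\<^sup>s h\<^sub>i\<^sup>u x\<^sub>i\<close> is
  bounded for \<open>\<bar>s\<bar> \<le> c R\<^sub>i\<close>, so it moves less and less between \<open>s = 0\<close> and \<open>s = 1\<close>, and \<open>p\<close> is fixed
  by \<open>g\<close>.
\<close>

section \<open>Polynomial curves of bounded degree\<close>

text \<open>The limit curve has to be fixed by all of \<open>G\<close>, whereas limits of orbits of
  a single one-parameter subgroup need only be fixed by that subgroup. Hence whole balls are used,
  and they must do two things with constants independent of the radius: absorb \<open>g^s\<close>
  for \<open>s\<close> up to a multiple of the radius, and contain a short initial piece
  \<open>h^u\<close> for every \<open>h\<close> of the doubled ball. The plain matrix norm fails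
  here, since \<open>g^s\<close> can grow like a power of \<open>s\<close> and norms multiply under
  products. Allowing size \<open>R^k\<close> at level \<open>k\<close> of the filtration repairs
  this: the powers of the ideal multiply, so products keep the same weights. Doubling the radius
  costs at most \<open>2^N\<close>, and a small \<open>u\<close> pays for it. Uniruledness asks for
  one degree for all points, so degree bounds are quantified before the curves throughout.\<close>

definition poly_fun :: "nat \<Rightarrow> (real \<Rightarrow> real) \<Rightarrow> bool" where
  "poly_fun d f \<longleftrightarrow> (\<exists>p. degree p \<le> d \<and> f = poly p)"

lemma poly_fun_const: "poly_fun d (\<lambda>u. c)"
  unfolding poly_fun_def by (rule exI[of _ "[:c:]"]) auto

lemma poly_fun_mono: "poly_fun d f \<Longrightarrow> d \<le> e \<Longrightarrow> poly_fun e f"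
  unfolding poly_fun_def using order.trans by blast

lemma poly_fun_add:
  assumes "poly_fun d f" "poly_fun d g" shows "poly_fun d (\<lambda>u. f u + g u)"
proof -
  obtain p q where "degree p \<le> d" "f = poly p" "degree q \<le> d" "g = poly q"
    using assms unfolding poly_fun_def by blast
  then show ?thesis
    unfolding poly_fun_def by (intro exI[of _ "p + q"]) (auto intro: degree_add_le)
qed

lemma poly_fun_mult:
  assumes "poly_fun d f" "poly_fun e g" shows "poly_fun (d + e) (\<lambda>u. f u * g u)"
proof -
  obtain p q where "degree p \<le> d" "f = poly p" "degree q \<le> e" "g = poly q"
    using assms unfolding poly_fun_def by blast
  then show ?thesis
    unfolding poly_fun_def
    by (intro exI[of _ "p * q"]) (auto intro: order.trans[OF degree_mult_le] add_mono)
qed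

lemma poly_fun_sum:
  "(\<And>i. i \<in> I \<Longrightarrow> poly_fun d (f i)) \<Longrightarrow> poly_fun d (\<lambda>u. \<Sum>i\<in>I. f i u)"
  by (induction I rule: infinite_finite_induct) (auto intro: poly_fun_const poly_fun_add)

lemma poly_fun_gchoose: "poly_fun k (\<lambda>u. u gchoose k)"
proof -
  have "poly_fun k (\<lambda>u. \<Prod>i<k. u - real i)"
  proof (induction k)
    case 0 show ?case using poly_fun_const[of 0 1] by simp
  next
    case (Suc k)
    have "poly_fun 1 (\<lambda>u. u - real k)"
      unfolding poly_fun_def by (rule exI[of _ "[:-real k, 1:]"]) auto
    from poly_fun_mult[OF Suc this] show ?case by simp
  qed
  from poly_fun_mult[OF this poly_fun_const[of 0 "1 / fact k"]] show ?thesis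
    by (simp add: gbinomial_prod_rev atLeast0LessThan)
qed

text \<open>Passes from integral to real exponents: a polynomial with infinitely many zeros
  vanishes.\<close>

lemma poly_fun_const_on_nat:
  assumes "poly_fun d f" "\<And>n. f (real n) = c"
  shows "f u = c"
proof -
  from assms(1) obtain p where p: "f = poly p" unfolding poly_fun_def by blast
  have "range real \<subseteq> {x. poly (p - [:c:]) x = 0}" using assms(2) p by auto
  then have "infinite {x. poly (p - [:c:]) x = 0}"
    using infinite_super range_inj_infinite[of real] by (auto simp: inj_on_def)
  then have "p - [:c:] = 0" using poly_roots_finite by blast
  then show ?thesis by (simp add: p)
qed

text \<open>Testing against all bounded linear functionals avoids coordinates: one notion serves
  matrices, points and pairs of them, and it matches the linear generators of
  \<open>real_polynomial_function\<close>.\<close>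

definition poly_curve :: "nat \<Rightarrow> (real \<Rightarrow> 'a::real_normed_vector) \<Rightarrow> bool" where
  "poly_curve d \<gamma> \<longleftrightarrow> (\<forall>l. bounded_linear l \<longrightarrow> poly_fun d (\<lambda>u. l (\<gamma> u)))"

lemma poly_curve_linear:
  assumes "poly_curve d \<gamma>" "bounded_linear h"
  shows "poly_curve d (\<lambda>u. h (\<gamma> u))"
  using assms bounded_linear_compose[of _ h] unfolding poly_curve_def o_def by blast

lemma poly_curve_const: "poly_curve d (\<lambda>u. c)"
  by (simp add: poly_curve_def poly_fun_const)

lemma poly_curve_Pair:
  assumes "poly_curve d f" "poly_curve d g"
  shows "poly_curve d (\<lambda>u. (f u, g u))"
  unfolding poly_curve_def
proof (intro allI impI)
  fix l :: "'a \<times> 'b \<Rightarrow> real" assume l: "bounded_linear l"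
  have "l (f u, g u) = l (f u, 0) + l (0, g u)" for u
    using linear_add[OF bounded_linear.linear[OF l], of "(f u, 0)" "(0, g u)"] by simp
  moreover have "bounded_linear (\<lambda>x. l (x, 0))" "bounded_linear (\<lambda>x. l (0, x))"
    by (intro bounded_linear_compose[OF l] bounded_linear_Pair bounded_linear_ident bounded_linear_zero)+
  ultimately have "(\<lambda>u. l (f u, g u)) = (\<lambda>u. l (f u, 0) + l (0, g u))"
    "poly_fun d (\<lambda>u. l (f u, 0))" "poly_fun d (\<lambda>u. l (0, g u))"
    using assms unfolding poly_curve_def by blast+
  then show "poly_fun d (\<lambda>u. l (f u, g u))" by (simp only: poly_fun_add)
qed

lemma poly_curve_sum_scaleR:
  assumes "\<And>k. k \<in> K \<Longrightarrow> poly_fun d (c k)"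
  shows "poly_curve d (\<lambda>u. \<Sum>k\<in>K. c k u *\<^sub>R y k)"
  unfolding poly_curve_def
proof (intro allI impI)
  fix l :: "'b \<Rightarrow> real" assume l: "bounded_linear l"
  interpret bounded_linear l by fact
  show "poly_fun d (\<lambda>u. l (\<Sum>k\<in>K. c k u *\<^sub>R y k))"
    using poly_fun_mult[OF assms poly_fun_const[of 0]]
    by (auto simp: sum scaleR intro!: poly_fun_sum)
qed

text \<open>The order of the quantifiers matters: \<open>e\<close> depends on \<open>f\<close> and
  \<open>d\<close> but not on the curve, since degree bounds are combined along the construction of
  \<open>f\<close>. This is the origin of the single degree for all fixed points.\<close>

lemma poly_fun_real_polynomial_compose:
  assumes "real_polynomial_function f"
  shows "\<exists>e. \<forall>\<gamma>. poly_curve d \<gamma> \<longrightarrow> poly_fun e (\<lambda>u. f (\<gamma> u))"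
  using assms
proof induction
  case (linear f) then show ?case unfolding poly_curve_def by blast
next
  case (const c) show ?case by (simp add: poly_fun_const)
next
  case (add f g)
  then obtain a b where "\<forall>\<gamma>. poly_curve d \<gamma> \<longrightarrow> poly_fun a (\<lambda>u. f (\<gamma> u))"
    "\<forall>\<gamma>. poly_curve d \<gamma> \<longrightarrow> poly_fun b (\<lambda>u. g (\<gamma> u))" by blast
  then show ?case
    by (intro exI[of _ "max a b"]) (auto intro!: poly_fun_add intro: poly_fun_mono)
next
  case (mult f g)
  then obtain a b where "\<forall>\<gamma>. poly_curve d \<gamma> \<longrightarrow> poly_fun a (\<lambda>u. f (\<gamma> u))"
    "\<forall>\<gamma>. poly_curve d \<gamma> \<longrightarrow> poly_fun b (\<lambda>u. g (\<gamma> u))" by blast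
  then show ?case by (intro exI[of _ "a + b"]) (auto intro!: poly_fun_mult)
qed

lemma poly_fun_coeffs:
  assumes "poly_fun d f" shows "\<exists>c. \<forall>u. f u = (\<Sum>k\<le>d. u ^ k * c k)"
proof -
  from assms obtain p where p: "degree p \<le> d" "f = poly p" unfolding poly_fun_def by blast
  have "f u = (\<Sum>k\<le>d. u ^ k * coeff p k)" for u
    using poly_as_sum_of_monoms'[OF p(1)] p(2)
    by (metis (mono_tags, lifting) mult.commute poly_monom poly_sum sum.cong)
  then show ?thesis by blast
qed

lemma poly_curve_polynomial_compose:
  fixes F :: "'a::real_normed_vector \<Rightarrow> real ^ 'n"
  assumes "polynomial_function F"
  shows "\<exists>e. \<forall>\<gamma>. poly_curve d \<gamma> \<longrightarrow> (\<exists>c. \<forall>u. F (\<gamma> u) = (\<Sum>k\<le>e. u ^ k *\<^sub>R c k))"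
proof -
  have "\<exists>e. \<forall>\<gamma>. poly_curve d \<gamma> \<longrightarrow> poly_fun e (\<lambda>u. F (\<gamma> u) $ i)" for i
    using assms poly_fun_real_polynomial_compose[of "\<lambda>x. F x $ i" d] bounded_linear_vec_nth[of i]
    unfolding polynomial_function_def o_def by blast
  then obtain e where e: "\<And>i \<gamma>. poly_curve d \<gamma> \<Longrightarrow> poly_fun (e i) (\<lambda>u. F (\<gamma> u) $ i)"
    by metis
  define E where "E = Max (range e)"
  have E: "poly_fun E (\<lambda>u. F (\<gamma> u) $ i)" if "poly_curve d \<gamma>" for i \<gamma>
    by (rule poly_fun_mono[OF e[OF that]]) (simp add: E_def)
  have "\<exists>c. \<forall>u. F (\<gamma> u) = (\<Sum>k\<le>E. u ^ k *\<^sub>R c k)" if "poly_curve d \<gamma>" for \<gamma>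
  proof -
    from poly_fun_coeffs[OF E[OF that]]
    obtain c where c: "\<And>i u. F (\<gamma> u) $ i = (\<Sum>k\<le>E. u ^ k * c i k)" by metis
    show ?thesis
      by (rule exI[of _ "\<lambda>k. \<chi> i. c i k"]) (auto simp: vec_eq_iff c)
  qed
  then show ?thesis by blast
qed

section \<open>Coefficients of a polynomial curve that is bounded on an interval\<close>

text \<open>Induction on the degree: \<open>2^(d+1) q(t/2) - q(t)\<close> has lost the leading term of \<open>q\<close>.\<close>

lemma coeff_bound:
  "\<exists>K\<ge>0. \<forall>(c :: nat \<Rightarrow> 'a::real_normed_vector) M.
     (\<forall>t. \<bar>t\<bar> \<le> 1 \<longrightarrow> norm (\<Sum>k\<le>d. t ^ k *\<^sub>R c k) \<le> M) \<longrightarrow> (\<forall>k\<le>d. norm (c k) \<le> K * M)"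
proof (induction d)
  case 0
  show ?case
  proof (rule exI[of _ 1], intro conjI allI impI)
    fix c :: "nat \<Rightarrow> 'a" and M and k :: nat
    assume M: "\<forall>t::real. \<bar>t\<bar> \<le> 1 \<longrightarrow> norm (\<Sum>k\<le>0. t ^ k *\<^sub>R c k) \<le> M" and "k \<le> 0"
    then show "norm (c k) \<le> 1 * M" using M[rule_format, of 0] by simp
  qed simp
next
  case (Suc d)
  then obtain K where K: "K \<ge> 0"
    "\<And>c M. (\<forall>t. \<bar>t\<bar> \<le> 1 \<longrightarrow> norm (\<Sum>k\<le>d. t ^ k *\<^sub>R (c k::'a)) \<le> M) \<Longrightarrow> (\<forall>k\<le>d. norm (c k) \<le> K * M)"
    by blast
  define K1 where "K1 = K * (2 ^ Suc d + 1)"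
  have K1: "K1 \<ge> 0" using K(1) by (simp add: K1_def)
  show ?case
  proof (rule exI[of _ "1 + (real d + 1) * K1"], intro conjI allI impI)
    show "1 + (real d + 1) * K1 \<ge> 0" using K1 by simp
    fix c :: "nat \<Rightarrow> 'a" and M k
    assume M: "\<forall>t. \<bar>t\<bar> \<le> 1 \<longrightarrow> norm (\<Sum>k\<le>Suc d. t ^ k *\<^sub>R c k) \<le> M" and k: "k \<le> Suc d"
    define q where "q t = (\<Sum>k\<le>Suc d. t ^ k *\<^sub>R c k)" for t :: real
    have M0: "M \<ge> 0" using M[rule_format, of 0] norm_ge_zero by (smt (verit))
    define c' where "c' k = (2 ^ (Suc d - k) - 1) *\<^sub>R c k" for k
    have eq: "(\<Sum>k\<le>d. t ^ k *\<^sub>R c' k) = 2 ^ Suc d *\<^sub>R q (t / 2) - q t" for t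
    proof -
      have "2 ^ Suc d *\<^sub>R q (t / 2) - q t
          = (\<Sum>k\<le>Suc d. (2 ^ Suc d * (t / 2) ^ k - t ^ k) *\<^sub>R c k)"
        by (simp only: q_def scaleR_sum_right sum_subtractf[symmetric] scaleR_scaleR scaleR_left_diff_distrib)
      also have "\<dots> = (\<Sum>k\<le>d. (2 ^ Suc d * (t / 2) ^ k - t ^ k) *\<^sub>R c k)"
        by (simp add: power_divide)
      also have "\<dots> = (\<Sum>k\<le>d. t ^ k *\<^sub>R c' k)"
      proof (rule sum.cong)
        fix k assume "k \<in> {..d}"
        then have "(2::real) ^ Suc d = 2 ^ k * 2 ^ (Suc d - k)"
          by (metis atMost_iff le_SucI le_add_diff_inverse power_add)
        then show "(2 ^ Suc d * (t / 2) ^ k - t ^ k) *\<^sub>R c k = t ^ k *\<^sub>R c' k"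
          by (simp add: c'_def power_divide algebra_simps)
      qed simp
      finally show ?thesis ..
    qed
    have "norm (\<Sum>k\<le>d. t ^ k *\<^sub>R c' k) \<le> (2 ^ Suc d + 1) * M" if "\<bar>t\<bar> \<le> 1" for t
    proof -
      have "norm (q t) \<le> M" "norm (q (t/2)) \<le> M"
        unfolding q_def by (rule M[rule_format], use that in simp)+
      then have "norm (2 ^ Suc d *\<^sub>R q (t / 2)) + norm (q t) \<le> 2 ^ Suc d * M + M"
        by (intro add_mono) auto
      then show ?thesis
        unfolding eq using norm_triangle_ineq4[of "2 ^ Suc d *\<^sub>R q (t / 2)" "q t"]
        by (simp only: distrib_right mult_1)
    qed
    with K(2)[of c' "(2 ^ Suc d + 1) * M"]
    have c': "norm (c' k) \<le> K1 * M" if "k \<le> d" for k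
      using that by (simp add: K1_def mult.assoc)
    have low: "norm (c k) \<le> K1 * M" if "k \<le> d" for k
    proof -
      \<comment> \<open>For \<open>k\<close> at most \<open>d\<close> the factor in
        \<open>c'\<close> is at least 1, so passing from \<open>c'\<close> back to \<open>c\<close>
        costs nothing.\<close>
      have "(2::real) ^ 1 \<le> 2 ^ (Suc d - k)" using that by (intro power_increasing) auto
      then have "1 * norm (c k) \<le> norm (c' k)"
        unfolding c'_def norm_scaleR by (intro mult_right_mono) auto
      with c'[OF that] show ?thesis by simp
    qed
    \<comment> \<open>The top coefficient, absent from \<open>c'\<close>, is recovered from the
      value at 1.\<close>
    have "norm (c (Suc d)) = norm (q 1 - (\<Sum>k\<le>d. c k))" by (simp add: q_def)
    also have "\<dots> \<le> norm (q 1) + norm (\<Sum>k\<le>d. c k)" by (rule norm_triangle_ineq4)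
    also have "\<dots> \<le> M + (real d + 1) * (K1 * M)"
    proof (rule add_mono)
      show "norm (q 1) \<le> M" unfolding q_def by (rule M[rule_format]) simp
      show "norm (\<Sum>k\<le>d. c k) \<le> (real d + 1) * (K1 * M)"
        using sum_norm_bound[of "{..d}" c "K1 * M"] low by (simp add: add.commute)
    qed
    finally have top: "norm (c (Suc d)) \<le> (1 + (real d + 1) * K1) * M" by (simp add: algebra_simps)
    have "K1 * M \<le> (1 + (real d + 1) * K1) * M"
      using K1 M0 by (intro mult_right_mono) (auto simp: algebra_simps)
    with low top k show "norm (c k) \<le> (1 + (real d + 1) * K1) * M"
      by (metis le_Suc_eq order.trans)
  qed
qed

lemma coeff_bound_scaled:
  "\<exists>K\<ge>0. \<forall>(c :: nat \<Rightarrow> 'a::real_normed_vector) M S. S > 0 \<longrightarrow>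
     (\<forall>t. \<bar>t\<bar> \<le> S \<longrightarrow> norm (\<Sum>k\<le>d. t ^ k *\<^sub>R c k) \<le> M) \<longrightarrow> (\<forall>k\<le>d. S ^ k * norm (c k) \<le> K * M)"
proof -
  from coeff_bound[where 'a='a, of d] obtain K where K: "K \<ge> 0"
    "\<And>c M. (\<forall>t. \<bar>t\<bar> \<le> 1 \<longrightarrow> norm (\<Sum>k\<le>d. t ^ k *\<^sub>R (c k::'a)) \<le> M) \<Longrightarrow> (\<forall>k\<le>d. norm (c k) \<le> K * M)"
    by blast
  have "\<forall>k\<le>d. S ^ k * norm (c k) \<le> K * M"
    if S: "S > 0" and M: "\<forall>t. \<bar>t\<bar> \<le> S \<longrightarrow> norm (\<Sum>k\<le>d. t ^ k *\<^sub>R c k) \<le> M"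
    for c :: "nat \<Rightarrow> 'a" and M S
  proof -
    have "norm (\<Sum>k\<le>d. t ^ k *\<^sub>R (S ^ k *\<^sub>R c k)) \<le> M" if "\<bar>t\<bar> \<le> 1" for t
    proof -
      have "\<bar>t * S\<bar> \<le> S" using that S by (simp add: abs_mult mult_le_cancel_right1)
      from M[rule_format, OF this] show ?thesis by (simp add: power_mult_distrib)
    qed
    with K(2)[of "\<lambda>k. S ^ k *\<^sub>R c k" M] S show ?thesis by simp
  qed
  with K(1) show ?thesis by blast
qed

text \<open>A curve of bounded degree that stays bounded on a long interval is slow near 0: the
  coefficient of \<open>t^k\<close> is at most \<open>K * M / S^k\<close>, hence at most
  \<open>K * M / S\<close> for \<open>k\<close> at least 1. The difference estimated is the value at
  1 minus the value at 0.\<close>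

lemma bounded_poly_increment:
  "\<exists>K\<ge>0. \<forall>(c :: nat \<Rightarrow> 'a::real_normed_vector) M S. S \<ge> 1 \<longrightarrow>
     (\<forall>t. \<bar>t\<bar> \<le> S \<longrightarrow> norm (\<Sum>k\<le>d. t ^ k *\<^sub>R c k) \<le> M) \<longrightarrow> norm ((\<Sum>k\<le>d. c k) - c 0) \<le> K * M / S"
proof -
  from coeff_bound_scaled[where 'a='a, of d] obtain K where K: "K \<ge> 0"
    "\<And>c M S. S > 0 \<Longrightarrow> (\<forall>t. \<bar>t\<bar> \<le> S \<longrightarrow> norm (\<Sum>k\<le>d. t ^ k *\<^sub>R (c k::'a)) \<le> M) \<Longrightarrow>
      (\<forall>k\<le>d. S ^ k * norm (c k) \<le> K * M)" by blast
  have "norm ((\<Sum>k\<le>d. c k) - c 0) \<le> (real d * K) * M / S"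
    if S: "S \<ge> 1" and M: "\<forall>t. \<bar>t\<bar> \<le> S \<longrightarrow> norm (\<Sum>k\<le>d. t ^ k *\<^sub>R c k) \<le> M"
    for c :: "nat \<Rightarrow> 'a" and M S
  proof -
    have "norm (c k) \<le> K * M / S" if "k \<in> {1..d}" for k
    proof -
      have "S ^ 1 \<le> S ^ k" using S that by (intro power_increasing) auto
      then have "S * norm (c k) \<le> S ^ k * norm (c k)" by (intro mult_right_mono) auto
      also have "\<dots> \<le> K * M" using K(2)[OF _ M] S that by auto
      finally show ?thesis using S by (simp add: field_simps)
    qed
    from sum_norm_bound[OF this]
    have "norm (\<Sum>k\<in>{1..d}. c k) \<le> real (card {1..d}) * (K * M / S)" .
    moreover have "{..d} - {0} = {1..d}" by auto
    then have "(\<Sum>k\<le>d. c k) = c 0 + (\<Sum>k\<in>{1..d}. c k)"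
      by (metis atMost_iff finite_atMost le0 sum.remove)
    ultimately show ?thesis by (simp add: mult.assoc)
  qed
  with K(1) show ?thesis by (intro exI[of _ "real d * K"]) auto
qed

lemma finitely_many_convergent_subseq:
  fixes f :: "nat \<Rightarrow> nat \<Rightarrow> 'a::heine_borel"
  assumes "\<And>k. k < n \<Longrightarrow> bounded (range (\<lambda>j. f j k))"
  shows "\<exists>r. strict_mono r \<and> (\<forall>k<n. \<exists>l. (\<lambda>j. f (r j) k) \<longlonglongrightarrow> l)"
  using assms
proof (induction n)
  case 0 show ?case by (rule exI[of _ id]) (simp add: strict_mono_def)
next
  case (Suc n)
  then obtain r where r: "strict_mono r" "\<forall>k<n. \<exists>l. (\<lambda>j. f (r j) k) \<longlonglongrightarrow> l" by (meson less_SucI)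
  have "bounded (range (\<lambda>j. f (r j) n))"
    by (rule bounded_subset[OF Suc.prems[of n]]) auto
  from bounded_imp_convergent_subsequence[OF this]
  obtain l s where s: "strict_mono s" "((\<lambda>j. f (r j) n) \<circ> s) \<longlonglongrightarrow> l" by blast
  have "\<exists>l. (\<lambda>j. f ((r \<circ> s) j) k) \<longlonglongrightarrow> l" if "k < Suc n" for k
  proof (cases "k = n")
    case True then show ?thesis using s(2) by (auto simp: o_def)
  next
    case False
    with that have "k < n" by simp
    with r(2) obtain l where "(\<lambda>j. f (r j) k) \<longlonglongrightarrow> l" by blast
    from LIMSEQ_subseq_LIMSEQ[OF this s(1)] show ?thesis by (auto simp: o_def)
  qed
  with strict_mono_o[OF r(1) s(1)] show ?case by blast
qed

section \<open>Nilpotency of the augmentation ideal\<close>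

lemma bounded_bilinear_matrix_mult:
  "bounded_bilinear ((**) :: real^'m^'m \<Rightarrow> real^'m^'m \<Rightarrow> real^'m^'m)"
proof -
  have "bilinear ((**) :: real^'m^'m \<Rightarrow> real^'m^'m \<Rightarrow> real^'m^'m)"
    unfolding bilinear_def
    by (auto intro!: linearI simp: matrix_matrix_mult_def vec_eq_iff algebra_simps sum.distrib
        sum_distrib_left)
  then show ?thesis by (simp add: bilinear_conv_bounded_bilinear)
qed

interpretation matmul: bounded_bilinear "(**) :: real^'m^'m \<Rightarrow> real^'m^'m \<Rightarrow> real^'m^'m"
  by (rule bounded_bilinear_matrix_mult)

lemma linear_trace: "linear (trace :: real^'m^'m \<Rightarrow> real)"
  by (auto intro!: linearI simp: trace_def sum.distrib sum_distrib_left)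

lemmas trace_scaleR = linear_scale[OF linear_trace]
lemmas trace_diff = linear_diff[OF linear_trace]

definition mpow :: "real^'m^'m \<Rightarrow> nat \<Rightarrow> real^'m^'m" where
  "mpow A k = (((**) A) ^^ k) (mat 1)"

lemma mpow_0 [simp]: "mpow A 0 = mat 1"
  and mpow_Suc: "mpow A (Suc k) = A ** mpow A k"
  by (simp_all add: mpow_def)

lemma mpow_add: "mpow A (i + j) = mpow A i ** mpow A j"
  by (induction i) (simp_all add: mpow_Suc matrix_mul_assoc)

section \<open>Traces of idempotent and nilpotent matrices\<close>

lemma orthonormal_basis_exists:
  fixes S :: "'a::euclidean_space set"
  assumes "subspace S"
  shows "\<exists>B. B \<subseteq> S \<and> pairwise orthogonal B \<and> (\<forall>b\<in>B. norm b = 1) \<and> finite B \<and> span B = S"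
proof (rule orthonormal_basis_subspace[OF assms])
  fix B :: "'a set"
  assume "B \<subseteq> S" "pairwise orthogonal B" "\<And>x. x \<in> B \<Longrightarrow> norm x = 1" "independent B" "span B = S"
  then show ?thesis using independent_imp_finite by blast
qed

text \<open>
  The trace of \<open>f\<close> on a subspace \<open>S\<close> with orthonormal basis \<open>B\<close> can be computed on any
  subspace of \<open>S\<close> containing \<open>f ` S\<close>.
\<close>

lemma trace_on_subspace:
  fixes f :: "'a::euclidean_space \<Rightarrow> 'a"
  assumes f: "linear f"
    and B: "pairwise orthogonal B" "\<And>b. b \<in> B \<Longrightarrow> norm b = 1" "finite B"
    and C: "pairwise orthogonal C" "\<And>c. c \<in> C \<Longrightarrow> norm c = 1" "finite C"
    and sub: "C \<subseteq> span B" and im: "\<And>x. x \<in> B \<Longrightarrow> f x \<in> span C"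
  shows "(\<Sum>b\<in>B. f b \<bullet> b) = (\<Sum>c\<in>C. f c \<bullet> c)"
proof -
  have "(\<Sum>b\<in>B. f b \<bullet> b) = (\<Sum>b\<in>B. (\<Sum>c\<in>C. (f b \<bullet> c) *\<^sub>R c) \<bullet> b)"
    by (intro sum.cong refl) (simp add: orthonormal_basis_expand[OF C(1,2) im C(3)])
  also have "\<dots> = (\<Sum>c\<in>C. \<Sum>b\<in>B. (f b \<bullet> c) * (c \<bullet> b))"
    by (simp add: inner_sum_left sum.swap[of _ C])
  also have "\<dots> = (\<Sum>c\<in>C. f (\<Sum>b\<in>B. (c \<bullet> b) *\<^sub>R b) \<bullet> c)"
    by (simp add: linear_sum[OF f] linear_scale[OF f] inner_sum_left mult.commute)
  also have "\<dots> = (\<Sum>c\<in>C. f c \<bullet> c)"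
    using sub by (intro sum.cong refl) (simp add: orthonormal_basis_expand[OF B(1,2) _ B(3)] subset_iff)
  finally show ?thesis .
qed

lemma trace_eq_sum_Basis: "trace A = (\<Sum>b\<in>Basis. (A *v b) \<bullet> b)" for A :: "real^'m^'m"
proof -
  have "(\<Sum>b\<in>Basis. (A *v b) \<bullet> b) = (\<Sum>i\<in>UNIV. (A *v axis i 1) \<bullet> axis i 1)"
    by (simp add: Basis_vec_def UNION_singleton_eq_range sum.reindex inj_on_def axis_eq_axis)
  also have "\<dots> = trace A"
    by (simp add: trace_def inner_axis matrix_vector_mult_basis column_def)
  finally show ?thesis ..
qed

lemma trace_via_range:
  fixes A :: "real^'m^'m"
  assumes C: "pairwise orthogonal C" "\<And>c. c \<in> C \<Longrightarrow> norm c = 1" "finite C"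
    and im: "range ((*v) A) \<subseteq> span C"
  shows "trace A = (\<Sum>c\<in>C. (A *v c) \<bullet> c)"
  unfolding trace_eq_sum_Basis
  by (rule trace_on_subspace)
     (use C im in \<open>auto simp: pairwise_def orthogonal_def inner_Basis\<close>)

text \<open>An idempotent is the identity on its range, so its trace is the dimension of that
  range.\<close>

lemma trace_idempotent_eq_0:
  fixes E :: "real^'m^'m"
  assumes E: "E ** E = E" and tr: "trace E = 0"
  shows "E = 0"
proof -
  have sub: "subspace (range ((*v) E))" by (rule linear_subspace_image[OF matrix_vector_mul_linear subspace_UNIV])
  obtain C where C: "C \<subseteq> range ((*v) E)" "pairwise orthogonal C" "\<And>c. c \<in> C \<Longrightarrow> norm c = 1"
    "finite C" "span C = range ((*v) E)"
    using orthonormal_basis_exists[OF sub] by blast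
  have "(E *v c) \<bullet> c = 1" if "c \<in> C" for c
  proof -
    from C(1) that obtain x where "c = E *v x" by auto
    then have "E *v c = c" by (simp add: matrix_vector_mul_assoc E)
    then show ?thesis using C(3)[OF that] by (simp add: dot_square_norm)
  qed
  then have "trace E = real (card C)"
    using trace_via_range[OF C(2,3,4)] C(5) by simp
  then have "C = {}" using tr C(4) by simp
  then have "E *v x = 0" for x using C(5) by auto
  then show ?thesis by (simp add: matrix_eq)
qed

text \<open>The trace of \<open>A\<close> equals that of its restriction to the range of
  \<open>A^j\<close> for every \<open>j\<close>, because \<open>A\<close> maps each of these ranges
  into the next; at \<open>j = k\<close> the range is zero.\<close>

lemma trace_nilpotent:
  fixes A :: "real^'m^'m"
  assumes "mpow A k = 0"
  shows "trace A = 0"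
proof -
  have "\<exists>C. pairwise orthogonal C \<and> (\<forall>c\<in>C. norm c = 1) \<and> finite C \<and>
      span C = range ((*v) (mpow A j)) \<and> trace A = (\<Sum>c\<in>C. (A *v c) \<bullet> c)" for j
  proof (induction j)
    case 0
    show ?case
      by (rule exI[of _ Basis])
         (auto simp: pairwise_def orthogonal_def inner_Basis trace_eq_sum_Basis)
  next
    case (Suc j)
    then obtain B where B: "pairwise orthogonal B" "\<And>c. c \<in> B \<Longrightarrow> norm c = 1" "finite B"
      "span B = range ((*v) (mpow A j))" "trace A = (\<Sum>c\<in>B. (A *v c) \<bullet> c)" by blast
    have sub: "subspace (range ((*v) (mpow A (Suc j))))" by (rule linear_subspace_image[OF matrix_vector_mul_linear subspace_UNIV])
    obtain C where C: "C \<subseteq> range ((*v) (mpow A (Suc j)))" "pairwise orthogonal C"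
      "\<And>c. c \<in> C \<Longrightarrow> norm c = 1" "finite C" "span C = range ((*v) (mpow A (Suc j)))"
      using orthonormal_basis_exists[OF sub] by blast
    have "mpow A (Suc j) = mpow A j ** A" using mpow_add[of A j 1] by (simp add: mpow_Suc)
    then have "C \<subseteq> span B" using C(1) B(4) by (auto simp: matrix_vector_mul_assoc[symmetric])
    moreover have "A *v b \<in> span C" if "b \<in> B" for b
    proof -
      from that B(4) obtain x where "b = mpow A j *v x" using span_base by blast
      then show ?thesis by (simp add: C(5) mpow_Suc matrix_vector_mul_assoc)
    qed
    ultimately have "trace A = (\<Sum>c\<in>C. (A *v c) \<bullet> c)"
      unfolding B(5)
      using B C by (intro trace_on_subspace) auto
    with C show ?case by blast
  qed
  from this[of k] obtain C where C: "\<forall>c\<in>C. norm c = 1" "finite C"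
      "span C = range ((*v) (mpow A k))" "trace A = (\<Sum>c\<in>C. (A *v c) \<bullet> c)" by blast
  have "c = 0" if "c \<in> C" for c using C(3) assms span_base[OF that] by auto
  then have "C = {}" using C(1) by fastforce
  with C(4) show ?thesis by simp
qed

text \<open>
  If \<open>span {x\<^sup>j | j \<ge> k}\<close> no longer shrinks, it contains a unit element, which is an idempotent
  of trace 0.
\<close>

lemma nilpotent_if_trace_powers_0:
  fixes x :: "real^'m^'m"
  assumes tr: "\<And>k. k \<ge> 1 \<Longrightarrow> trace (mpow x k) = 0"
  shows "\<exists>k\<ge>1. mpow x k = 0"
proof -
  define S where "S k = span (mpow x ` {k..})" for k
  have S_mono: "S l \<subseteq> S k" if "k \<le> l" for k l
    unfolding S_def using that by (intro span_mono image_mono) auto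
  \<comment> \<open>The spaces \<open>S l\<close> decrease, so from an index of least dimension on
    they are all equal.\<close>
  obtain k0 where k0: "\<And>l. dim (S k0) \<le> dim (S l)"
    using ex_has_least_nat[of "\<lambda>_. True" 0 "\<lambda>k. dim (S k)"] by auto
  \<comment> \<open>The shift by one makes every exponent in \<open>S k\<close> positive, so that
    all traces on \<open>S k\<close> vanish.\<close>
  define k where "k = Suc k0"
  have "S (k + k) = S k0"
  proof (rule subspace_dim_equal)
    show "subspace (S (k + k))" "subspace (S k0)" by (simp_all add: S_def)
    show "S (k + k) \<subseteq> S k0" by (rule S_mono) (simp add: k_def)
    show "dim (S k0) \<le> dim (S (k + k))" by (rule k0)
  qed
  moreover have "mpow x k \<in> S k0" unfolding S_def by (rule span_base) (simp add: k_def)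
  ultimately have "mpow x k \<in> S (k + k)" by simp
  also have "S (k + k) = span ((**) (mpow x k) ` mpow x ` {k..})"
  proof -
    have "{k + k..} = (+) k ` {k..}" by simp
    then have "mpow x ` {k + k..} = (**) (mpow x k) ` mpow x ` {k..}"
      by (simp only: image_image mpow_add)
    then show ?thesis by (simp add: S_def)
  qed
  also have "\<dots> = (**) (mpow x k) ` S k"
    unfolding S_def by (rule span_linear_image) (rule bounded_linear.linear[OF matmul.bounded_linear_right])
  finally obtain e where e: "e \<in> S k" "mpow x k = mpow x k ** e" by blast
  \<comment> \<open>Every generator is \<open>x^j ** x^k\<close>, so \<open>x^k = x^k ** e\<close>
    makes \<open>e\<close> a right unit on all of \<open>S k\<close>; as \<open>e\<close> lies in
    \<open>S k\<close>, it is idempotent.\<close>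
  have unit: "y ** e = y" if "y \<in> S k" for y
    using that unfolding S_def
  proof (induction rule: span_induct_alt)
    case base show ?case by simp
  next
    case (step c a y)
    from step(1) obtain j where "a = mpow x (k + j)" by (auto simp: le_iff_add)
    then have "a ** e = a"
      using e(2) by (metis add.commute matrix_mul_assoc mpow_add)
    with step show ?case by (simp add: matmul.add_left matmul.scaleR_left)
  qed
  have "trace y = 0" if "y \<in> S k" for y
    using that unfolding S_def
  proof (induction rule: span_induct_alt)
    case base show ?case using linear_0[OF linear_trace] .
  next
    case (step c a y) then show ?case
      using tr by (auto simp: trace_add trace_scaleR k_def)
  qed
  with e(1) have "e = 0" using unit[OF e(1)] trace_idempotent_eq_0 by blast
  then have "mpow x k = 0" using e(2) by simp
  then show ?thesis by (intro exI[of _ k]) (simp add: k_def)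
qed

text \<open>The setting of the nilpotency argument. Algebraicity enters in
  \<open>unipotent_algebraic_group\<close>, where real powers have to stay in
  \<open>G\<close>.\<close>

locale unipotent_matrices =
  fixes G :: "(real^'m^'m) set"
  assumes one: "mat 1 \<in> G"
    and mult: "g \<in> G \<Longrightarrow> h \<in> G \<Longrightarrow> g ** h \<in> G"
    and inv: "g \<in> G \<Longrightarrow> \<exists>h\<in>G. g ** h = mat 1 \<and> h ** g = mat 1"
    and unip: "g \<in> G \<Longrightarrow> unipotent_matrix g"
begin

text \<open>\<open>J k\<close> is the \<open>k\<close>-th power of the augmentation ideal of the algebra spanned by \<open>G\<close>.\<close>

fun J :: "nat \<Rightarrow> (real^'m^'m) set" where
  "J 0 = span G"
| "J (Suc k) = span {(g - mat 1) ** y | g y. g \<in> G \<and> y \<in> J k}"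

lemma subspace_J: "subspace (J k)" by (cases k) simp_all

lemma J_Suc_I: "g \<in> G \<Longrightarrow> y \<in> J k \<Longrightarrow> (g - mat 1) ** y \<in> J (Suc k)"
  by (auto intro: span_base)

text \<open>The identity \<open>g (h - 1) = (g h - 1) - (g - 1)\<close> rewrites a multiplied
  generator as a difference of two generators.\<close>

lemma G_mult_J: "g \<in> G \<Longrightarrow> y \<in> J k \<Longrightarrow> g ** y \<in> J k"
proof (induction k arbitrary: g y)
  case 0
  from 0(2) show ?case unfolding J.simps
  proof (induction rule: span_induct_alt)
    case base show ?case by (simp add: span_zero)
  next
    case (step c x y) then show ?case
      using 0(1) by (auto simp: matmul.add_right matmul.scaleR_right intro!: span_add span_scale intro: span_base mult)
  qed
next
  case (Suc k)
  from Suc(3) show ?case unfolding J.simps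
  proof (induction rule: span_induct_alt)
    case base show ?case by (simp add: span_zero)
  next
    case (step c x y)
    then obtain h z where x: "x = (h - mat 1) ** z" "h \<in> G" "z \<in> J k" by blast
    have "g ** x = (g ** h - mat 1) ** z - (g - mat 1) ** z"
      by (simp add: x(1) matmul.diff_left matmul.diff_right matrix_mul_assoc)
    also have "\<dots> \<in> J (Suc k)"
      by (intro subspace_diff subspace_J J_Suc_I mult Suc x)
    finally show ?case using step
      by (auto simp: matmul.add_right matmul.scaleR_right intro!: span_add span_scale)
  qed
qed

text \<open>Multiplicativity of the filtration is what lets the weights \<open>R^i\<close> and
  \<open>R^j\<close> combine to \<open>R^(i+j)\<close> in \<open>E_mult\<close>.\<close>

lemma J_mult: "x \<in> J k \<Longrightarrow> y \<in> J l \<Longrightarrow> x ** y \<in> J (k + l)"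
proof (induction k arbitrary: x)
  case 0
  from 0(1) show ?case unfolding J.simps
  proof (induction rule: span_induct_alt)
    case base show ?case using subspace_0[OF subspace_J] by (simp del: J.simps)
  next
    case (step c g z) then show ?case
      using G_mult_J[OF step(1) 0(2)] subspace_J
      by (simp add: matmul.add_left matmul.scaleR_left subspace_add subspace_scale)
  qed
next
  case (Suc k)
  from Suc(2) show ?case unfolding J.simps
  proof (induction rule: span_induct_alt)
    case base show ?case using subspace_0[OF subspace_J] by (simp del: J.simps)
  next
    case (step c x z)
    then obtain h w where x: "x = (h - mat 1) ** w" "h \<in> G" "w \<in> J k" by blast
    have "x ** y \<in> J (Suc k + l)"
      using J_Suc_I[OF x(2) Suc.IH[OF x(3) Suc.prems(2)]] by (simp add: x(1) matrix_mul_assoc)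
    then show ?case using step(2) subspace_J
      by (simp add: matmul.add_left matmul.scaleR_left subspace_add subspace_scale del: J.simps)
  qed
qed

lemma J_Suc_subset: "J (Suc k) \<subseteq> J k"
proof -
  have "(g - mat 1) ** y \<in> J k" if "g \<in> G" "y \<in> J k" for g y
    using that G_mult_J[of g y k] subspace_diff[OF subspace_J] by (simp add: matmul.diff_left)
  then show ?thesis
    unfolding J.simps(2) by (intro span_minimal subspace_J) auto
qed

lemma diff_one_in_J: "g \<in> G \<Longrightarrow> g - mat 1 \<in> J 1"
  using J_Suc_I[of g "mat 1" 0] span_base[OF one] by simp

lemma mpow_in_J:
  assumes "g \<in> G" shows "mpow (g - mat 1) k \<in> J k"
proof (induction k)
  case 0 show ?case using span_base[OF one] by simp
next
  case (Suc k) then show ?case unfolding mpow_Suc by (rule J_Suc_I[OF assms])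
qed

lemma trace_G: "g \<in> G \<Longrightarrow> trace g = real CARD('m)"
proof -
  assume "g \<in> G"
  then obtain k where "mpow (g - mat 1) k = 0"
    using unip unfolding unipotent_matrix_def mpow_def by blast
  from trace_nilpotent[OF this] show ?thesis by (simp add: trace_diff trace_I)
qed

text \<open>By \<open>trace_G\<close> the trace is constant on \<open>G\<close>, so it has the same
  value on \<open>g ** h\<close> and on \<open>h\<close>, and their difference
  \<open>(g - 1) h\<close> has trace 0.\<close>

lemma trace_J1: "x \<in> J 1 \<Longrightarrow> trace x = 0"
  unfolding One_nat_def J.simps
proof (induction rule: span_induct_alt)
  case base show ?case using linear_0[OF linear_trace] .
next
  case (step c x y)
  then obtain g z where x: "x = (g - mat 1) ** z" "g \<in> G" "z \<in> span G" by blast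
  from x(3) have "trace ((g - mat 1) ** z) = 0"
  proof (induction rule: span_induct_alt)
    case base show ?case using linear_0[OF linear_trace] by simp
  next
    case (step c h w)
    then show ?case
      using trace_G[OF mult[OF x(2)]] trace_G
      by (simp add: matmul.diff_left matmul.add_right matmul.scaleR_right trace_add trace_diff trace_scaleR)
  qed
  with step show ?case by (simp add: x(1) trace_add trace_scaleR)
qed

lemma nilpotent_J1:
  assumes "x \<in> J 1" shows "\<exists>k\<ge>1. mpow x k = 0"
proof (rule nilpotent_if_trace_powers_0)
  fix k :: nat assume k: "k \<ge> 1"
  have "mpow x (Suc j) \<in> J 1" for j
  proof (induction j)
    case 0 show ?case using assms by (simp add: mpow_Suc)
  next
    case (Suc j)
    from J_mult[OF assms this] J_Suc_subset[of 1] show ?case by (auto simp: mpow_Suc[of x "Suc j"] simp del: J.simps)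
  qed
  from this[of "k - 1"] k show "trace (mpow x k) = 0" using trace_J1 by simp
qed

text \<open>
  Nakayama's argument with a maximal proper submodule; the augmentation ideal is nil by the
  vanishing of traces.
\<close>

lemma J_Suc_neq:
  assumes "J k \<noteq> {0}" shows "J (Suc k) \<noteq> J k"
proof
  assume eq: "J (Suc k) = J k"
  \<comment> \<open>Submodules for left multiplication by \<open>G\<close>; a proper one of largest
    dimension will be the maximal submodule.\<close>
  define sm where "sm W \<longleftrightarrow> subspace W \<and> (\<forall>g\<in>G. \<forall>y\<in>W. g ** y \<in> W)" for W :: "(real^'m^'m) set"
  define proper where "proper W \<longleftrightarrow> sm W \<and> W \<subseteq> J k \<and> W \<noteq> J k" for W
  have "sm {0}" by (simp add: sm_def)
  then have "proper {0}" unfolding proper_def using assms subspace_0[OF subspace_J[of k]] by blast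
  moreover have "dim W < Suc (dim (J k))" if "proper W" for W
    using that unfolding proper_def less_Suc_eq_le by (intro dim_subset) blast
  ultimately have "\<exists>W. proper W \<and> (\<forall>W'. proper W' \<longrightarrow> dim W' \<le> dim W)"
    by (intro ex_has_greatest_nat[of proper "{0}" dim "Suc (dim (J k))"]) auto
  then obtain W where W: "proper W" "\<And>W'. proper W' \<Longrightarrow> dim W' \<le> dim W" by blast
  have subW: "subspace W" and smW: "\<And>g y. g \<in> G \<Longrightarrow> y \<in> W \<Longrightarrow> g ** y \<in> W" and WJ: "W \<subset> J k"
    using W(1) unfolding proper_def sm_def by blast+
  have "\<not> {(g - mat 1) ** y | g y. g \<in> G \<and> y \<in> J k} \<subseteq> W"
  proof
    assume "{(g - mat 1) ** y | g y. g \<in> G \<and> y \<in> J k} \<subseteq> W"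
    from span_minimal[OF this subW] have "J (Suc k) \<subseteq> W" by (simp only: J.simps(2))
    with eq WJ show False by blast
  qed
  then obtain g w where gw: "g \<in> G" "w \<in> J k" "(g - mat 1) ** w \<notin> W" by blast
  \<comment> \<open>\<open>M\<close> is \<open>J 1 w + W\<close>. It is a submodule of
    \<open>J k\<close> that contains \<open>W\<close> and also \<open>(g - 1) w\<close>, which is
    outside \<open>W\<close>; by maximality it can only be all of \<open>J k\<close>.\<close>
  define M where "M = {x ** w + v | x v. x \<in> J 1 \<and> v \<in> W}"
  have J1W: "x ** v \<in> W" if "x \<in> J 1" "v \<in> W" for x v
    using that(1) unfolding One_nat_def J.simps
  proof (induction rule: span_induct_alt)
    case base show ?case using subspace_0[OF subW] by simp
  next
    case (step c x y)
    then obtain g z where x: "x = (g - mat 1) ** z" "g \<in> G" "z \<in> span G" by blast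
    from x(3) have "z ** v \<in> W"
    proof (induction rule: span_induct_alt)
      case base show ?case using subspace_0[OF subW] by simp
    next
      case (step c h w) then show ?case
        using that(2) subW smW by (simp add: matmul.add_left matmul.scaleR_left subspace_add subspace_scale)
    qed
    then have "x ** v \<in> W"
      using smW[OF x(2), of "z ** v"] subspace_diff[OF subW]
      by (simp add: x(1) matmul.diff_left matrix_mul_assoc[symmetric])
    with step show ?case
      using subW by (simp add: matmul.add_left matmul.scaleR_left subspace_add subspace_scale)
  qed
  have M_intro: "x ** w + v \<in> M" if "x \<in> J 1" "v \<in> W" for x v
    using that unfolding M_def by blast
  have "M = J k"
  proof (rule ccontr)
    assume neq: "M \<noteq> J k"
    have "subspace M" unfolding subspace_def
    proof (intro conjI ballI allI)
      show "0 \<in> M" using M_intro[OF subspace_0[OF subspace_J] subspace_0[OF subW]] by simp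
    next
      fix a b assume "a \<in> M" "b \<in> M"
      then obtain x v x' v' where ab: "a = x ** w + v" "b = x' ** w + v'"
        "x \<in> J 1" "x' \<in> J 1" "v \<in> W" "v' \<in> W" unfolding M_def by blast
      have "a + b = (x + x') ** w + (v + v')" by (simp add: ab matmul.add_left)
      then show "a + b \<in> M"
        using M_intro[OF subspace_add[OF subspace_J ab(3,4)] subspace_add[OF subW ab(5,6)]] by simp
    next
      fix a c assume "a \<in> M"
      then obtain x v where a: "a = x ** w + v" "x \<in> J 1" "v \<in> W" unfolding M_def by blast
      have "c *\<^sub>R a = (c *\<^sub>R x) ** w + c *\<^sub>R v" by (simp add: a matmul.scaleR_left scaleR_add_right)
      then show "c *\<^sub>R a \<in> M"
        using M_intro[OF subspace_scale[OF subspace_J a(2)] subspace_scale[OF subW a(3)]] by simp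
    qed
    moreover have "h ** a \<in> M" if "h \<in> G" "a \<in> M" for h a
    proof -
      from that obtain x v where a: "a = x ** w + v" "x \<in> J 1" "v \<in> W" unfolding M_def by blast
      have "h ** a = (h ** x) ** w + h ** v" by (simp add: a matmul.add_right matrix_mul_assoc)
      then show ?thesis using M_intro[OF G_mult_J[OF that(1) a(2)] smW[OF that(1) a(3)]] by simp
    qed
    moreover have "M \<subseteq> J k"
    proof
      fix a assume "a \<in> M"
      then obtain x v where a: "a = x ** w + v" "x \<in> J 1" "v \<in> W" unfolding M_def by blast
      have "x ** w \<in> J k" using J_mult[OF a(2) gw(2)] eq by simp
      then show "a \<in> J k" unfolding a(1) using a(3) WJ by (intro subspace_add[OF subspace_J]) auto
    qed
    ultimately have "proper M" using neq unfolding proper_def sm_def by blast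
    then have "dim M \<le> dim W" by (rule W(2))
    moreover have "W \<subseteq> M" using M_intro[OF subspace_0[OF subspace_J]] by fastforce
    ultimately have "W = M" using subW \<open>subspace M\<close> by (metis subspace_dim_equal)
    moreover have "(g - mat 1) ** w \<in> M"
      using M_intro[OF diff_one_in_J[OF gw(1)] subspace_0[OF subW]] by simp
    ultimately show False using gw(3) by blast
  qed
  with gw(2) obtain x v where x: "w = x ** w + v" "x \<in> J 1" "v \<in> W" unfolding M_def by blast
  \<comment> \<open>Modulo \<open>W\<close>, \<open>w = x w = x^2 w = ...\<close>, and nilpotency of
    \<open>x\<close> puts \<open>w\<close> itself into \<open>W\<close>.\<close>
  have *: "w - mpow x j ** w \<in> W" for j
  proof (induction j)
    case 0 show ?case using subspace_0[OF subW] by simp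
  next
    case (Suc j)
    have "w - mpow x (Suc j) ** w = v + x ** (w - mpow x j ** w)"
      using x(1) by (simp add: mpow_Suc matmul.diff_right matrix_mul_assoc algebra_simps)
    then show ?case using J1W[OF x(2) Suc] x(3) subspace_add[OF subW] by simp
  qed
  from nilpotent_J1[OF x(2)] obtain j where "mpow x j = 0" by blast
  with *[of j] have "w \<in> W" by simp
  then have "(g - mat 1) ** w \<in> W" by (rule J1W[OF diff_one_in_J[OF gw(1)]])
  with gw(3) show False by blast
qed

text \<open>By \<open>J_Suc_neq\<close> the dimension drops at every step until it reaches
  zero.\<close>

lemma J_eventually_0: "\<exists>N. \<forall>k\<ge>N. J k = {0}"
proof -
  have "dim (J k) + k \<le> dim (J 0) \<or> J k = {0}" for k
  proof (induction k)
    case (Suc k)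
    show ?case
    proof (cases "J k = {0}")
      case True
      then have "J (Suc k) = {0}"
        using J_Suc_subset[of k] subspace_0[OF subspace_J[of "Suc k"]] by blast
      then show ?thesis ..
    next
      case False
      then have "\<not> dim (J k) \<le> dim (J (Suc k))"
        using J_Suc_neq subspace_dim_equal[OF subspace_J subspace_J J_Suc_subset] by blast
      with False Suc show ?thesis by linarith
    qed
  qed simp
  then have "J k = {0}" if "k \<ge> Suc (dim (J 0))" for k
    using that by (metis add_leD2 not_less_eq_eq)
  then show ?thesis by blast
qed

end

section \<open>One-parameter subgroups and balls\<close>

lemma gbinomial_Suc_factor: "u gchoose Suc k = (u gchoose k) * (u - real k) / (real k + 1)"
  by (simp add: gbinomial_prod_rev fact_Suc atLeast0LessThan field_simps)

text \<open>The ratio \<open>(u - k) / (k + 1)\<close> of successive coefficients is at most 1 in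
  absolute value, which leaves the first factor \<open>u\<close>. That linear factor makes
  \<open>h^u\<close> close to 1 for small \<open>u\<close>.\<close>

lemma abs_gbinomial_le:
  assumes "\<bar>u\<bar> \<le> 1" "k \<ge> 1" shows "\<bar>u gchoose k\<bar> \<le> \<bar>u :: real\<bar>"
  using assms(2)
proof (induction rule: dec_induct)
  case base show ?case by simp
next
  case (step k)
  have "\<bar>u - real k\<bar> \<le> real k + 1" using assms(1) by linarith
  then have "\<bar>u gchoose k\<bar> * \<bar>u - real k\<bar> \<le> \<bar>u\<bar> * (real k + 1)"
    using step.IH by (intro mult_mono) auto
  then show ?case by (simp add: gbinomial_Suc_factor abs_mult divide_le_eq)
qed

text \<open>The exponent \<open>k\<close> is the one of the weight at level \<open>k\<close>; the
  summand \<open>n\<close> covers the shifts in the factors \<open>s - k\<close>.\<close>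

lemma abs_gbinomial_le_power:
  assumes "k \<le> n" shows "\<bar>s gchoose k\<bar> \<le> (\<bar>s :: real\<bar> + real n) ^ k"
  using assms
proof (induction k)
  case (Suc k)
  have "\<bar>s gchoose k\<bar> * \<bar>s - real k\<bar> \<le> (\<bar>s\<bar> + real n) ^ k * (\<bar>s\<bar> + real n)"
    using Suc by (intro mult_mono) auto
  also have "\<dots> \<le> (\<bar>s\<bar> + real n) ^ k * (\<bar>s\<bar> + real n) * (real k + 1)"
    using mult_left_mono[of 1 "real k + 1" "(\<bar>s\<bar> + real n) ^ k * (\<bar>s\<bar> + real n)"] by simp
  finally show ?case
    by (simp add: gbinomial_Suc_factor abs_mult divide_le_eq mult.commute)
qed simp

context unipotent_matrices
begin

declare J.simps [simp del]

definition N :: nat where "N = (SOME N. \<forall>k\<ge>N. J k = {0})"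

lemma J_ge_N: "k \<ge> N \<Longrightarrow> J k = {0}"
  unfolding N_def using someI_ex[OF J_eventually_0] by blast

lemma mpow_ge_N: "g \<in> G \<Longrightarrow> k \<ge> N \<Longrightarrow> mpow (g - mat 1) k = 0"
  using mpow_in_J[of g k] J_ge_N[of k] by blast

text \<open>The real power \<open>g\<^sup>s\<close>; the binomial series terminates by nilpotency.\<close>

definition rpow :: "real^'m^'m \<Rightarrow> real \<Rightarrow> real^'m^'m" where
  "rpow g s = (\<Sum>k\<le>N. (s gchoose k) *\<^sub>R mpow (g - mat 1) k)"

lemma rpow_split: "rpow g s = mat 1 + (\<Sum>k=1..N. (s gchoose k) *\<^sub>R mpow (g - mat 1) k)"
proof -
  have "{..N} = insert 0 {1..N}" by auto
  then show ?thesis unfolding rpow_def by simp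
qed

lemma rpow_0: "rpow g 0 = mat 1"
  unfolding rpow_split using abs_gbinomial_le[of 0] by (auto intro!: sum.neutral)

text \<open>Pascal's rule. Multiplication by \<open>x\<close> shifts the sum by one level, and the
  term that overshoots, \<open>mpow x (Suc N)\<close>, is zero.\<close>

lemma rpow_add_one:
  assumes "g \<in> G" shows "rpow g (s + 1) = g ** rpow g s"
proof -
  define x where "x = g - mat 1"
  have x0: "mpow x (Suc N) = 0" using mpow_ge_N[OF assms] by (simp add: x_def)
  have "x ** rpow g s = (\<Sum>k\<le>N. (s gchoose k) *\<^sub>R mpow x (Suc k))"
    by (simp add: rpow_def x_def matmul.sum_right matmul.scaleR_right mpow_Suc)
  also have "\<dots> = (\<Sum>k<N. (s gchoose k) *\<^sub>R mpow x (Suc k))"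
    using x0 by (simp add: lessThan_Suc_atMost[symmetric])
  finally have 1: "x ** rpow g s = (\<Sum>k<N. (s gchoose k) *\<^sub>R mpow x (Suc k))" .
  have 2: "rpow g t = mat 1 + (\<Sum>k<N. (t gchoose Suc k) *\<^sub>R mpow x (Suc k))" for t
  proof -
    have "rpow g t = (\<Sum>k<Suc N. (t gchoose k) *\<^sub>R mpow x k)"
      by (simp add: rpow_def x_def lessThan_Suc_atMost)
    then show ?thesis by (simp only: sum.lessThan_Suc_shift) simp
  qed
  have "g ** rpow g s = rpow g s + x ** rpow g s"
    by (simp add: x_def matmul.diff_left)
  also have "\<dots> = rpow g s + (\<Sum>k<N. (s gchoose k) *\<^sub>R mpow x (Suc k))" by (simp only: 1)
  also have "\<dots> = rpow g (s + 1)"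
    unfolding 2[of s] 2[of "s + 1"]
    by (simp add: gbinomial_Suc_Suc scaleR_left_distrib sum.distrib)
  finally show ?thesis ..
qed

lemma rpow_1: "g \<in> G \<Longrightarrow> rpow g 1 = g"
  using rpow_add_one[of g 0] by (simp add: rpow_0)

lemma rpow_nat_in_G: "g \<in> G \<Longrightarrow> rpow g (real n) \<in> G"
proof (induction n)
  case 0 then show ?case by (simp add: rpow_0 one)
next
  case (Suc n) then show ?case
    using rpow_add_one[of g "real n"] by (simp add: mult add.commute)
qed

lemma poly_curve_rpow: "poly_curve N (rpow g)"
  unfolding rpow_def
  by (rule poly_curve_sum_scaleR) (auto intro: poly_fun_mono[OF poly_fun_gchoose])

lemma rpow_diff_one_in_J:
  assumes "g \<in> G" shows "rpow g s - mat 1 \<in> J 1"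
proof -
  have "J k \<subseteq> J 1" if "k \<ge> 1" for k
    using that by (induction rule: dec_induct) (use J_Suc_subset in blast)+
  then have "(\<Sum>k=1..N. (s gchoose k) *\<^sub>R mpow (g - mat 1) k) \<in> J 1"
    using mpow_in_J[OF assms] by (intro subspace_sum subspace_J subspace_scale) auto
  then show ?thesis by (simp add: rpow_split)
qed

text \<open>A nonzero vector killed by \<open>g^s\<close> would be an eigenvector of
  \<open>g^s - 1\<close> for the eigenvalue -1, but that matrix lies in \<open>J 1\<close> and is
  nilpotent. Membership in \<open>G\<close> asks for invertibility beside the polynomial
  equations.\<close>

lemma invertible_rpow:
  assumes "g \<in> G" shows "invertible (rpow g s)"
proof -
  define y where "y = rpow g s - mat 1"
  obtain k where k: "mpow y k = 0"
    using nilpotent_J1[OF rpow_diff_one_in_J[OF assms]] unfolding y_def by blast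
  have "v = 0" if v: "rpow g s *v v = 0" for v
  proof -
    have yv: "y *v v = - v" using v by (simp add: y_def matrix_vector_mult_diff_rdistrib)
    have "mpow y j *v v = (-1) ^ j *\<^sub>R v" for j
    proof (induction j)
      case (Suc j)
      have "mpow y (Suc j) *v v = y *v ((-1) ^ j *\<^sub>R v)"
        by (simp add: mpow_Suc Suc matrix_vector_mul_assoc[symmetric])
      then show ?case by (simp add: matrix_vector_mult_scaleR yv)
    qed simp
    from this[of k] k show ?thesis by simp
  qed
  then have "\<exists>B. B ** rpow g s = mat 1"
    unfolding matrix_left_invertible_ker by blast
  then show ?thesis by (simp add: invertible_left_inverse)
qed

section \<open>Balls weighted by the powers of the augmentation ideal\<close>

text \<open>Weighting \<open>J k\<close> by \<open>R ^ k\<close> makes products of these sets grow by constants independent of \<open>R\<close>.\<close>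

definition E :: "real \<Rightarrow> real \<Rightarrow> (real^'m^'m) set" where
  "E C R = {A. \<exists>y. (\<forall>k\<in>{1..N}. y k \<in> J k \<and> norm (y k) \<le> C * R ^ k) \<and> A = (\<Sum>k=1..N. y k)}"

lemma E_mono:
  assumes "A \<in> E C R" "\<And>k. k \<in> {1..N} \<Longrightarrow> C * R ^ k \<le> C' * R' ^ k"
  shows "A \<in> E C' R'"
proof -
  from assms(1) obtain y where y: "\<forall>k\<in>{1..N}. y k \<in> J k \<and> norm (y k) \<le> C * R ^ k" "A = (\<Sum>k=1..N. y k)"
    unfolding E_def by blast
  have "\<forall>k\<in>{1..N}. y k \<in> J k \<and> norm (y k) \<le> C' * R' ^ k"
    using y(1) assms(2) order.trans by blast
  with y(2) show ?thesis unfolding E_def by blast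
qed

lemma E_add:
  assumes "A \<in> E C R" "B \<in> E C' R" shows "A + B \<in> E (C + C') R"
proof -
  from assms obtain y z where yz: "\<forall>k\<in>{1..N}. y k \<in> J k \<and> norm (y k) \<le> C * R ^ k" "A = (\<Sum>k=1..N. y k)"
    "\<forall>k\<in>{1..N}. z k \<in> J k \<and> norm (z k) \<le> C' * R ^ k" "B = (\<Sum>k=1..N. z k)"
    unfolding E_def by blast
  have "\<forall>k\<in>{1..N}. y k + z k \<in> J k \<and> norm (y k + z k) \<le> (C + C') * R ^ k"
    using yz subspace_add[OF subspace_J] by (auto simp: distrib_right intro!: norm_triangle_mono)
  then show ?thesis unfolding E_def yz(2,4)
    by (auto simp: sum.distrib intro!: exI[of _ "\<lambda>k. y k + z k"])
qed

lemma E_scale: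
  assumes "A \<in> E C R" shows "s *\<^sub>R A \<in> E (\<bar>s\<bar> * C) R"
proof -
  from assms obtain y where y: "\<forall>k\<in>{1..N}. y k \<in> J k \<and> norm (y k) \<le> C * R ^ k" "A = (\<Sum>k=1..N. y k)"
    unfolding E_def by blast
  have "\<forall>k\<in>{1..N}. s *\<^sub>R y k \<in> J k \<and> norm (s *\<^sub>R y k) \<le> (\<bar>s\<bar> * C) * R ^ k"
    using y subspace_scale[OF subspace_J] by (auto simp: mult.assoc intro!: mult_left_mono)
  then show ?thesis unfolding E_def y(2)
    by (auto simp: scaleR_sum_right intro!: exI[of _ "\<lambda>k. s *\<^sub>R y k"])
qed

lemma zero_in_E: "C \<ge> 0 \<Longrightarrow> R \<ge> 0 \<Longrightarrow> 0 \<in> E C R"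
  unfolding E_def by (intro CollectI exI[of _ "\<lambda>k. 0"]) (simp add: subspace_0[OF subspace_J])

lemma E_sum:
  assumes "finite I" "R \<ge> 0" "\<And>i. i \<in> I \<Longrightarrow> f i \<in> E (c i) R"
  shows "(\<Sum>i\<in>I. f i) \<in> E (\<Sum>i\<in>I. c i) R"
  using assms(1,3) by (induction I) (simp_all add: E_add zero_in_E assms(2))

text \<open>A product of levels \<open>i\<close> and \<open>j\<close> may land beyond
  \<open>N\<close>; there \<open>J k\<close> is zero and nothing has to be placed.\<close>

lemma E_homogeneous:
  assumes "y \<in> J k" "k \<ge> 1" "norm y \<le> C * R ^ k" "C \<ge> 0" "R \<ge> 0"
  shows "y \<in> E C R"
proof (cases "k \<le> N")
  case True
  then have "\<forall>j\<in>{1..N}. (if j = k then y else 0) \<in> J j \<and> norm (if j = k then y else 0) \<le> C * R ^ j"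
    using assms subspace_0[OF subspace_J] by (auto)
  then show ?thesis unfolding E_def using True assms(2)
    by (auto intro!: exI[of _ "\<lambda>j. if j = k then y else 0"])
next
  case False
  then have "y = 0" using assms(1) J_ge_N[of k] by auto
  then show ?thesis using zero_in_E assms by simp
qed

text \<open>The weights at levels \<open>i\<close> and \<open>j\<close> multiply to exactly the
  weight allowed at \<open>i + j\<close>, so \<open>\<kappa>\<close> does not depend on
  \<open>R\<close>. It counts the \<open>N * N\<close> pairs of levels, times the norm constant of
  matrix multiplication.\<close>

lemma E_mult:
  "\<exists>\<kappa>\<ge>0. \<forall>A B C C' R. C \<ge> 0 \<longrightarrow> C' \<ge> 0 \<longrightarrow> R \<ge> 0 \<longrightarrow> A \<in> E C R \<longrightarrow> B \<in> E C' R \<longrightarrow>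
     A ** B \<in> E (\<kappa> * C * C') R"
proof -
  obtain \<mu> where \<mu>: "\<mu> \<ge> 0"
    "\<And>A B. norm ((A :: real^'m^'m) ** (B :: real^'m^'m)) \<le> norm A * norm B * \<mu>"
    using matmul.nonneg_bounded by blast
  have "A ** B \<in> E ((real N * real N * \<mu>) * C * C') R"
    if C: "C \<ge> 0" "C' \<ge> 0" "R \<ge> 0" and AB: "A \<in> E C R" "B \<in> E C' R" for A B C C' R
  proof -
    from AB obtain y z where yz: "\<forall>k\<in>{1..N}. y k \<in> J k \<and> norm (y k) \<le> C * R ^ k"
      "A = (\<Sum>k=1..N. y k)"
      "\<forall>k\<in>{1..N}. z k \<in> J k \<and> norm (z k) \<le> C' * R ^ k" "B = (\<Sum>k=1..N. z k)"
      unfolding E_def by blast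
    have "y i ** z j \<in> E (\<mu> * C * C') R" if "i \<in> {1..N}" "j \<in> {1..N}" for i j
    proof (rule E_homogeneous)
      show "y i ** z j \<in> J (i + j)" using J_mult yz(1,3) that by blast
      have "norm (y i ** z j) \<le> norm (y i) * norm (z j) * \<mu>" by (rule \<mu>(2))
      also have "\<dots> \<le> (C * R ^ i) * (C' * R ^ j) * \<mu>"
        using bspec[OF yz(1) that(1)] bspec[OF yz(3) that(2)] C \<mu>(1) by (intro mult_mono mult_right_mono) auto
      finally show "norm (y i ** z j) \<le> \<mu> * C * C' * R ^ (i + j)"
        by (simp add: power_add algebra_simps)
    qed (use that C \<mu>(1) in auto)
    then have "(\<Sum>i=1..N. \<Sum>j=1..N. y i ** z j) \<in> E (\<Sum>i=1..N. \<Sum>j=1..N. \<mu> * C * C') R"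
      by (intro E_sum C) auto
    moreover have "A ** B = (\<Sum>i=1..N. \<Sum>j=1..N. y i ** z j)"
      by (simp only: yz(2) matmul.sum_left) (simp only: yz(4) matmul.sum_right)
    ultimately show ?thesis by (simp add: algebra_simps)
  qed
  with \<mu>(1) show ?thesis by (intro exI[of _ "real N * real N * \<mu>"]) auto
qed

text \<open>Analogue of a ball around the unit for a homogeneous norm on a nilpotent Lie group: the
  component at level \<open>k\<close> may have size \<open>R^k\<close>.\<close>

definition B :: "real \<Rightarrow> (real^'m^'m) set" where
  "B R = {g \<in> G. g - mat 1 \<in> E 1 R}"

lemma bounded_B: "bounded (B R)"
proof -
  have "norm g \<le> norm (mat 1 :: real^'m^'m) + (\<Sum>k=1..N. R ^ k)" if "g \<in> B R" for g
  proof -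
    from that obtain y where y: "\<And>k. k \<in> {1..N} \<Longrightarrow> norm (y k) \<le> R ^ k" "g - mat 1 = (\<Sum>k=1..N. y k)"
      unfolding B_def E_def mult_1 by blast
    have "norm (g - mat 1) \<le> (\<Sum>k=1..N. R ^ k)" unfolding y(2) by (rule sum_norm_le[OF y(1)])
    then show ?thesis using norm_triangle_sub[of g "mat 1"] by linarith
  qed
  then show ?thesis unfolding bounded_iff by blast
qed

text \<open>The constant \<open>L\<close> depends on \<open>g\<close>, but the radius is linear in
  \<open>s\<close>: a one-parameter subgroup runs through the balls at linear speed at most.\<close>

lemma rpow_in_E:
  assumes "g \<in> G"
  shows "\<exists>L\<ge>0. \<forall>s. rpow g s - mat 1 \<in> E L (\<bar>s\<bar> + real N)"
proof -
  define L where "L = (\<Sum>k=1..N. norm (mpow (g - mat 1) k))"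
  have "rpow g s - mat 1 \<in> E L (\<bar>s\<bar> + real N)" for s
  proof -
    have "(s gchoose k) *\<^sub>R mpow (g - mat 1) k \<in> J k \<and>
        norm ((s gchoose k) *\<^sub>R mpow (g - mat 1) k) \<le> L * (\<bar>s\<bar> + real N) ^ k" if "k \<in> {1..N}" for k
    proof
      show "(s gchoose k) *\<^sub>R mpow (g - mat 1) k \<in> J k"
        by (intro subspace_scale subspace_J mpow_in_J assms)
      have "norm (mpow (g - mat 1) k) \<le> L" unfolding L_def by (rule member_le_sum[OF that]) auto
      then have "\<bar>s gchoose k\<bar> * norm (mpow (g - mat 1) k) \<le> (\<bar>s\<bar> + real N) ^ k * L"
        using that by (intro mult_mono abs_gbinomial_le_power) auto
      then show "norm ((s gchoose k) *\<^sub>R mpow (g - mat 1) k) \<le> L * (\<bar>s\<bar> + real N) ^ k"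
        by (simp add: mult.commute)
    qed
    then show ?thesis unfolding E_def rpow_split
      by (intro CollectI exI[of _ "\<lambda>k. (s gchoose k) *\<^sub>R mpow (g - mat 1) k"]) simp
  qed
  moreover have "L \<ge> 0" unfolding L_def by (intro sum_nonneg) auto
  ultimately show ?thesis by blast
qed

text \<open>Unlike in \<open>rpow_in_E\<close>, the constant \<open>M\<close> serves all
  \<open>g\<close> of a ball and all radii, and the factor \<open>\<bar>u\<bar>\<close> makes short
  powers small relative to the ball.\<close>

lemma rpow_in_E_uniform:
  "\<exists>M\<ge>0. \<forall>R\<ge>0. \<forall>g u. g - mat 1 \<in> E 1 R \<longrightarrow> \<bar>u\<bar> \<le> 1 \<longrightarrow> rpow g u - mat 1 \<in> E (\<bar>u\<bar> * M) R"
proof -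
  obtain \<kappa> where \<kappa>: "\<kappa> \<ge> 0" "\<And>A B C C' R. C \<ge> 0 \<Longrightarrow> C' \<ge> 0 \<Longrightarrow> R \<ge> 0 \<Longrightarrow> A \<in> E C R \<Longrightarrow> B \<in> E C' R \<Longrightarrow>
     A ** B \<in> E (\<kappa> * C * C') R" using E_mult by blast
  \<comment> \<open>A \<open>k\<close>-th power takes \<open>k - 1\<close> multiplications, each at
    the cost of one \<open>\<kappa>\<close>.\<close>
  define M where "M = (\<Sum>k=1..N. \<kappa> ^ (k - 1))"
  have "rpow g u - mat 1 \<in> E (\<bar>u\<bar> * M) R" if R: "R \<ge> 0" and g: "g - mat 1 \<in> E 1 R" and u: "\<bar>u\<bar> \<le> 1" for R g u
  proof -
    have "mpow (g - mat 1) (Suc k) \<in> E (\<kappa> ^ k) R" for k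
    proof (induction k)
      case 0 show ?case using g by (simp add: mpow_Suc)
    next
      case (Suc k)
      from \<kappa>(2)[OF _ _ R g Suc] \<kappa>(1) show ?case by (simp add: mpow_Suc[of _ "Suc k"])
    qed
    then have *: "mpow (g - mat 1) k \<in> E (\<kappa> ^ (k - 1)) R" if "k \<ge> 1" for k
      using that by (metis Suc_diff_le diff_Suc_1 One_nat_def)
    have "(\<Sum>k=1..N. (u gchoose k) *\<^sub>R mpow (g - mat 1) k) \<in> E (\<Sum>k=1..N. \<bar>u gchoose k\<bar> * \<kappa> ^ (k - 1)) R"
      by (intro E_sum R E_scale *) auto
    moreover have "(\<Sum>k=1..N. \<bar>u gchoose k\<bar> * \<kappa> ^ (k - 1)) \<le> \<bar>u\<bar> * M"
      unfolding M_def sum_distrib_left using \<kappa>(1) u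
      by (intro sum_mono mult_right_mono abs_gbinomial_le) auto
    ultimately show ?thesis
      unfolding rpow_split using R by (auto elim!: E_mono intro!: mult_right_mono)
  qed
  moreover have "M \<ge> 0" unfolding M_def using \<kappa>(1) by (intro sum_nonneg) auto
  ultimately show ?thesis by blast
qed

end

locale unipotent_algebraic_group = unipotent_matrices +
  assumes algebraic: "\<exists>V. algebraic_set V \<and> G = V \<inter> {A. invertible A}"
begin

text \<open>The defining polynomials of \<open>G\<close> are polynomial in \<open>s\<close> along
  \<open>g^s\<close> and vanish at all natural \<open>s\<close>, hence at every real
  \<open>s\<close>.\<close>

lemma rpow_in_G:
  assumes "g \<in> G" shows "rpow g s \<in> G"
proof -
  from algebraic obtain V where V: "algebraic_set V" "G = V \<inter> {A. invertible A}" by blast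
  then obtain P where P: "\<forall>p\<in>P. real_polynomial_function p" "V = {x. \<forall>p\<in>P. p x = 0}"
    unfolding algebraic_set_def by blast
  have "p (rpow g s) = 0" if p: "p \<in> P" for p
  proof -
    obtain e where "poly_fun e (\<lambda>s. p (rpow g s))"
      using poly_fun_real_polynomial_compose[of p N] P(1) p poly_curve_rpow by blast
    moreover have "p (rpow g (real n)) = 0" for n
      using rpow_nat_in_G[OF assms, of n] V(2) P(2) p by blast
    ultimately show ?thesis by (rule poly_fun_const_on_nat)
  qed
  then show ?thesis using V(2) P(2) invertible_rpow[OF assms] by blast
qed

text \<open>The factor \<open>1 + L\<close> in the radius absorbs \<open>L\<close>, because its
  \<open>k\<close>-th power is at least \<open>L\<close> for \<open>k\<close> at least 1.\<close>

lemma rpow_eventually_in_B: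
  assumes "g \<in> G" shows "\<exists>R0. \<forall>R\<ge>R0. rpow g s \<in> B R"
proof -
  obtain L where L: "L \<ge> 0" "rpow g s - mat 1 \<in> E L (\<bar>s\<bar> + real N)" using rpow_in_E[OF assms] by blast
  have "rpow g s \<in> B R" if R: "R \<ge> (1 + L) * (\<bar>s\<bar> + real N)" for R
  proof -
    have "L * (\<bar>s\<bar> + real N) ^ k \<le> 1 * R ^ k" if "k \<in> {1..N}" for k
    proof -
      have "(1 + L) ^ 1 \<le> (1 + L) ^ k" using L(1) that by (intro power_increasing) auto
      then have "L * (\<bar>s\<bar> + real N) ^ k \<le> (1 + L) ^ k * (\<bar>s\<bar> + real N) ^ k"
        by (intro mult_right_mono) auto
      also have "\<dots> = ((1 + L) * (\<bar>s\<bar> + real N)) ^ k" by (simp add: power_mult_distrib)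
      also have "\<dots> \<le> R ^ k" using R L(1) by (intro power_mono) auto
      finally show ?thesis by simp
    qed
    from E_mono[OF L(2) this] show ?thesis unfolding B_def using rpow_in_G[OF assms] by blast
  qed
  then show ?thesis by blast
qed

text \<open>With \<open>a = g^s - 1\<close> and \<open>b = h^u - 1\<close> one has
  \<open>g^s h^u - 1 = a + b + a b\<close>, and the constants below keep the sum of the three terms
  in \<open>E 1 R\<close>. The range \<open>c\<close> of \<open>u\<close> is common to all
  \<open>g\<close>, so one interval of the limit curve can be tested against every \<open>g\<close>;
  \<open>c'\<close> and \<open>R0\<close> may depend on \<open>g\<close>.\<close>

lemma rpow_mult_rpow_in_B:
  "\<exists>c>0. \<forall>g\<in>G. \<exists>c'>0. \<exists>R0. \<forall>R\<ge>R0. \<forall>h\<in>B (2 * R). \<forall>u s.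
     \<bar>u\<bar> \<le> c \<longrightarrow> \<bar>s\<bar> \<le> c' * R \<longrightarrow> rpow g s ** rpow h u \<in> B R"
proof -
  obtain \<kappa> where \<kappa>: "\<kappa> \<ge> 0" "\<And>A B C C' R. C \<ge> 0 \<Longrightarrow> C' \<ge> 0 \<Longrightarrow> R \<ge> 0 \<Longrightarrow> A \<in> E C R \<Longrightarrow> B \<in> E C' R \<Longrightarrow>
     A ** B \<in> E (\<kappa> * C * C') R" using E_mult by blast
  obtain M where M: "M \<ge> 0" "\<And>R g u. R \<ge> 0 \<Longrightarrow> g - mat 1 \<in> E 1 R \<Longrightarrow> \<bar>u\<bar> \<le> 1 \<Longrightarrow>
      rpow g u - mat 1 \<in> E (\<bar>u\<bar> * M) R" using rpow_in_E_uniform by blast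
  \<comment> \<open>The factor \<open>2^N\<close> pays for passing from radius \<open>2 * R\<close>
    to \<open>R\<close> at levels up to \<open>N\<close>; the rest brings \<open>h^u - 1\<close>
    down to a quarter.\<close>
  define c where "c = 1 / (1 + 4 * M * 2 ^ N)"
  have c: "c > 0" "c \<le> 1" using M(1) by (auto simp: c_def add_pos_nonneg)
  have cM: "c * M * 2 ^ N \<le> 1 / 4"
  proof -
    have "0 < 1 + 4 * M * 2 ^ N" using M(1) by (simp add: add_pos_nonneg)
    then show ?thesis by (simp add: c_def field_simps)
  qed
  \<comment> \<open>With this choice \<open>\<beta> + 1/4 + \<kappa> * \<beta> / 4\<close> stays
    below 1.\<close>
  define \<beta> where "\<beta> = 1 / (4 + 4 * \<kappa>)"
  have \<beta>: "\<beta> > 0" "\<beta> \<le> 1 / 4" "\<kappa> * \<beta> \<le> 1 / 4" using \<kappa>(1) by (auto simp: \<beta>_def field_simps)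
  have "\<exists>c'>0. \<exists>R0. \<forall>R\<ge>R0. \<forall>h\<in>B (2 * R). \<forall>u s.
     \<bar>u\<bar> \<le> c \<longrightarrow> \<bar>s\<bar> \<le> c' * R \<longrightarrow> rpow g s ** rpow h u \<in> B R" if g: "g \<in> G" for g
  proof -
    obtain L where L: "L \<ge> 0" "\<And>s. rpow g s - mat 1 \<in> E L (\<bar>s\<bar> + real N)"
      using rpow_in_E[OF g] by blast
    \<comment> \<open>The fraction of \<open>R\<close> that \<open>\<bar>s\<bar> + N\<close> may
      reach: \<open>L * \<eta>\<close> is at most \<open>\<beta>\<close>, and
      \<open>\<eta>^k \<le> \<eta>\<close> for \<open>k\<close> at least 1. One half of it is left
      to \<open>s\<close>, the other half absorbs \<open>N\<close> once \<open>R\<close> is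
      large.\<close>
    define \<eta> where "\<eta> = \<beta> / (\<beta> + L)"
    have \<eta>: "\<eta> > 0" "\<eta> \<le> 1" "L * \<eta> \<le> \<beta>"
      using \<beta>(1) L(1) by (auto simp: \<eta>_def field_simps)
    have "rpow g s ** rpow h u \<in> B R"
      if R: "R \<ge> 2 * real N / \<eta>" and h: "h \<in> B (2 * R)" and u: "\<bar>u\<bar> \<le> c" and s: "\<bar>s\<bar> \<le> \<eta> / 2 * R" for R h u s
    proof -
      have R0: "R \<ge> 0" using R \<eta>(1) by (meson divide_nonneg_pos mult_nonneg_nonneg of_nat_0_le_iff order.trans zero_le_numeral)
      have hG: "h \<in> G" using h unfolding B_def by blast
      have "rpow h u - mat 1 \<in> E (\<bar>u\<bar> * M) (2 * R)"
        using M(2)[of "2 * R" h u] R0 h u c unfolding B_def by auto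
      then have 1: "rpow h u - mat 1 \<in> E (1/4) R"
      proof (rule E_mono)
        fix k assume k: "k \<in> {1..N}"
        have "\<bar>u\<bar> * M * 2 ^ k \<le> c * M * 2 ^ N"
          using u M(1) c k by (intro mult_mono power_increasing) auto
        with cM have "\<bar>u\<bar> * M * 2 ^ k \<le> 1 / 4" by linarith
        from mult_right_mono[OF this, of "R ^ k"] show "\<bar>u\<bar> * M * (2 * R) ^ k \<le> 1/4 * R ^ k"
          using R0 by (simp add: power_mult_distrib mult.assoc)
      qed
      have "\<bar>s\<bar> + real N \<le> \<eta> * R" using R s \<eta>(1) by (simp add: field_simps)
      have 2: "rpow g s - mat 1 \<in> E \<beta> R"
      proof (rule E_mono[OF L(2)])
        fix k assume k: "k \<in> {1..N}"
        have "(\<bar>s\<bar> + real N) ^ k \<le> (\<eta> * R) ^ k"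
          using \<open>\<bar>s\<bar> + real N \<le> \<eta> * R\<close> by (intro power_mono) auto
        also have "\<dots> \<le> \<eta> ^ 1 * R ^ k"
          unfolding power_mult_distrib using k \<eta> R0 by (intro mult_right_mono power_decreasing) auto
        finally have "L * (\<bar>s\<bar> + real N) ^ k \<le> L * (\<eta> ^ 1 * R ^ k)" using L(1) by (intro mult_left_mono) auto
        also have "\<dots> \<le> \<beta> * R ^ k"
          using mult_right_mono[OF \<eta>(3), of "R ^ k"] R0 by (simp add: mult.assoc)
        finally show "L * (\<bar>s\<bar> + real N) ^ k \<le> \<beta> * R ^ k" .
      qed
      have "(rpow g s - mat 1) + (rpow h u - mat 1) + (rpow g s - mat 1) ** (rpow h u - mat 1)
          \<in> E (\<beta> + 1/4 + \<kappa> * \<beta> * (1/4)) R"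
        by (rule E_add[OF E_add[OF 2 1] \<kappa>(2)[OF _ _ R0 2 1]]) (use \<beta>(1) in auto)
      then have "rpow g s ** rpow h u - mat 1 \<in> E (\<beta> + 1/4 + \<kappa> * \<beta> * (1/4)) R"
        by (simp add: matmul.diff_left matmul.diff_right algebra_simps)
      then have "rpow g s ** rpow h u - mat 1 \<in> E 1 R"
        by (rule E_mono) (use \<beta> R0 in \<open>intro mult_right_mono; simp\<close>)
      then show ?thesis unfolding B_def using mult rpow_in_G g hG by blast
    qed
    then show ?thesis using \<eta>(1) by (intro exI[of _ "\<eta> / 2"] conjI exI[of _ "2 * real N / \<eta>"]) auto
  qed
  with c(1) show ?thesis by blast
qed

end

section \<open>Limits of orbit segments\<close>

lemma poly_fun_zero_on_interval:
  assumes "poly_fun d f" "c > 0" "\<And>u. \<bar>u\<bar> \<le> c \<Longrightarrow> f u = 0"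
  shows "f u = 0"
proof -
  from assms(1) obtain p where p: "f = poly p" unfolding poly_fun_def by blast
  have "{-c..c} \<subseteq> {x. poly p x = 0}" using assms(3) p by auto
  then have "infinite {x. poly p x = 0}"
    by (rule infinite_super) (use assms(2) in \<open>simp add: infinite_Icc\<close>)
  then have "p = 0" using poly_roots_finite by blast
  then show ?thesis by (simp add: p)
qed

lemma poly_curve_monomial_sum:
  "poly_curve d (\<lambda>u. \<Sum>k\<le>d. u ^ k *\<^sub>R c k)"
proof (rule poly_curve_sum_scaleR)
  fix k assume "k \<in> {..d}"
  then show "poly_fun d (\<lambda>u. u ^ k)"
    unfolding poly_fun_def by (intro exI[of _ "monom 1 k"]) (auto simp: poly_monom degree_monom_eq)
qed

text \<open>\<open>F\<close> is a polynomial map on the whole space that agrees with the action on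
  \<open>G \<times> X\<close>; limits and polynomial identities are taken in \<open>F\<close>, since
  \<open>\<phi>\<close> is meaningful on \<open>X\<close> alone.\<close>

locale unipotent_action = unipotent_algebraic_group G for G :: "(real^'m^'m) set" +
  fixes X :: "(real^'n) set" and \<phi> :: "real^'m^'m \<Rightarrow> real^'n \<Rightarrow> real^'n"
    and F :: "(real^'m^'m) \<times> (real^'n) \<Rightarrow> real^'n"
  assumes closed_X: "closed X"
    and act_closed: "g \<in> G \<Longrightarrow> x \<in> X \<Longrightarrow> \<phi> g x \<in> X"
    and act_mult: "g \<in> G \<Longrightarrow> h \<in> G \<Longrightarrow> x \<in> X \<Longrightarrow> \<phi> (g ** h) x = \<phi> g (\<phi> h x)"
    and act_one: "x \<in> X \<Longrightarrow> \<phi> (mat 1) x = x"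
    and polynomial_F: "polynomial_function F"
    and act_F: "g \<in> G \<Longrightarrow> x \<in> X \<Longrightarrow> \<phi> g x = F (g, x)"
begin

text \<open>The curve \<open>s \<mapsto> (g^s h, x)\<close> has degree at most \<open>N\<close>, so
  one \<open>d\<close> serves all \<open>x\<close>, \<open>g\<close> and \<open>h\<close>. The
  factor \<open>h\<close> is 1 when an orbit curve itself is studied, and a real power when a point
  of such a curve is moved by \<open>g^s\<close>.\<close>

lemma act_curve:
  "\<exists>d. \<forall>x\<in>X. \<forall>g\<in>G. \<forall>h\<in>G. \<exists>c. \<forall>s. \<phi> (rpow g s ** h) x = (\<Sum>k\<le>d. s ^ k *\<^sub>R c k)"
proof -
  obtain d where d: "\<And>\<gamma>. poly_curve N \<gamma> \<Longrightarrow> \<exists>c. \<forall>u. F (\<gamma> u) = (\<Sum>k\<le>d. u ^ k *\<^sub>R c k)"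
    using poly_curve_polynomial_compose[OF polynomial_F] by blast
  have "\<exists>c. \<forall>s. \<phi> (rpow g s ** h) x = (\<Sum>k\<le>d. s ^ k *\<^sub>R c k)"
    if "x \<in> X" "g \<in> G" "h \<in> G" for x g h
  proof -
    have "poly_curve N (\<lambda>s. (rpow g s ** h, x))"
      by (intro poly_curve_Pair poly_curve_const poly_curve_linear[OF poly_curve_rpow matmul.bounded_linear_left])
    from d[OF this] show ?thesis
      using act_F[OF mult[OF rpow_in_G] \<open>x \<in> X\<close>] that by simp
  qed
  then show ?thesis by blast
qed

text \<open>If all balls of large radius moved \<open>x\<close> by at most 1, the polynomial curve
  \<open>s \<mapsto> g^s x\<close> would be bounded on the whole line, hence constant, against
  \<open>\<phi> g x \<noteq> x\<close>.\<close>

lemma nonfixed_unbounded: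
  assumes x: "x \<in> X" and g: "g \<in> G" and neq: "\<phi> g x \<noteq> x"
  shows "\<exists>j\<ge>i. \<exists>h\<in>B (2 ^ j). dist (\<phi> h x) x > 1"
proof (rule ccontr)
  assume "\<not> ?thesis"
  then have bd: "dist (\<phi> h x) x \<le> 1" if "h \<in> B (2 ^ j)" "j \<ge> i" for h j using that by force
  obtain d where "\<forall>x\<in>X. \<forall>g\<in>G. \<forall>h\<in>G. \<exists>c. \<forall>s. \<phi> (rpow g s ** h) x = (\<Sum>k\<le>d. s ^ k *\<^sub>R c k)"
    using act_curve by blast
  with x g one have "\<exists>c. \<forall>s. \<phi> (rpow g s ** mat 1) x = (\<Sum>k\<le>d. s ^ k *\<^sub>R c k)" by blast
  then obtain c where c: "\<And>s. \<phi> (rpow g s) x = (\<Sum>k\<le>d. s ^ k *\<^sub>R c k)" by auto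
  have le: "norm (\<Sum>k\<le>d. s ^ k *\<^sub>R c k) \<le> norm x + 1" for s
  proof -
    obtain R0 where R0: "\<And>R. R \<ge> R0 \<Longrightarrow> rpow g s \<in> B R" using rpow_eventually_in_B[OF g] by blast
    obtain j0 where "R0 < 2 ^ j0" using real_arch_pow[of 2 R0] by auto
    also have "(2::real) ^ j0 \<le> 2 ^ max i j0" by (intro power_increasing) auto
    finally have "dist (\<phi> (rpow g s) x) x \<le> 1" using bd R0 by (meson less_imp_le max.cobounded1)
    then show ?thesis unfolding c[symmetric] dist_norm using norm_triangle_sub[of _ x] by (smt (verit))
  qed
  obtain K where K: "K \<ge> 0" "\<And>(c::nat \<Rightarrow> real^'n) M S. S \<ge> 1 \<Longrightarrow>
     (\<forall>t. \<bar>t\<bar> \<le> S \<longrightarrow> norm (\<Sum>k\<le>d. t ^ k *\<^sub>R c k) \<le> M) \<Longrightarrow> norm ((\<Sum>k\<le>d. c k) - c 0) \<le> K * M / S"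
    using bounded_poly_increment[of d] by blast
  define e where "e = norm ((\<Sum>k\<le>d. c k) - c 0)"
  have c1: "(\<Sum>k\<le>d. c k) = \<phi> g x" using c[of 1] rpow_1[OF g] by simp
  have "(\<Sum>k\<le>d. 0 ^ k *\<^sub>R c k) = (\<Sum>k\<in>{0}. c k)" by (rule sum.mono_neutral_cong_right) auto
  then have c0: "c 0 = x" using c[of 0] rpow_0 act_one[OF x] by simp
  have "e > 0" unfolding e_def c1 c0 using neq by simp
  have "e \<le> K * (norm x + 1) / S" if "S \<ge> 1" for S
    unfolding e_def using K(2)[OF that] le by blast
  from this[of "1 + K * (norm x + 1) / e"] \<open>e > 0\<close> K(1)
  have "e * (1 + K * (norm x + 1) / e) \<le> K * (norm x + 1)"
    by (simp add: pos_le_divide_eq add_pos_nonneg)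
  with \<open>e > 0\<close> have "e * e \<le> 0" by (simp add: field_simps)
  with \<open>e > 0\<close> show False using mult_pos_pos[of e e] by linarith
qed

text \<open>The curve is given by coefficients because these are what converges: their limits keep
  the degree bound \<open>d\<close>, which is chosen before \<open>a\<close>. The parameters 0 and 1
  witness that the curve is not constant.\<close>

lemma curve_of_fixed_points:
  "\<exists>d. \<forall>a\<in>fixed_points G X \<phi>. (\<forall>\<delta>>0. \<exists>x\<in>X. dist x a < \<delta> \<and> x \<notin> fixed_points G X \<phi>) \<longrightarrow>
     (\<exists>l. (\<Sum>k\<le>d. 0 ^ k *\<^sub>R l k) = a \<and> (\<Sum>k\<le>d. 1 ^ k *\<^sub>R l k) \<noteq> a \<and>
        (\<forall>u. (\<Sum>k\<le>d. u ^ k *\<^sub>R l k) \<in> fixed_points G X \<phi>))"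
proof -
  obtain d where d: "\<forall>x\<in>X. \<forall>g\<in>G. \<forall>h\<in>G. \<exists>c. \<forall>s. \<phi> (rpow g s ** h) x = (\<Sum>k\<le>d. s ^ k *\<^sub>R c k)"
    using act_curve by blast
  obtain c where c: "c > 0" "\<forall>g\<in>G. \<exists>c'>0. \<exists>R0. \<forall>R\<ge>R0. \<forall>h\<in>B (2 * R). \<forall>u s.
     \<bar>u\<bar> \<le> c \<longrightarrow> \<bar>s\<bar> \<le> c' * R \<longrightarrow> rpow g s ** rpow h u \<in> B R"
    using rpow_mult_rpow_in_B by blast
  have contF: "continuous_on UNIV F" using polynomial_F by (rule continuous_on_polymonial_function)
  have "\<exists>l. (\<Sum>k\<le>d. 0 ^ k *\<^sub>R l k) = a \<and> (\<Sum>k\<le>d. 1 ^ k *\<^sub>R l k) \<noteq> a \<and>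
        (\<forall>u. (\<Sum>k\<le>d. u ^ k *\<^sub>R l k) \<in> fixed_points G X \<phi>)"
    if a: "a \<in> fixed_points G X \<phi>"
      and acc: "\<forall>\<delta>>0. \<exists>x\<in>X. dist x a < \<delta> \<and> x \<notin> fixed_points G X \<phi>" for a
  proof -
    have aX: "a \<in> X" and fixa: "\<And>g. g \<in> G \<Longrightarrow> \<phi> g a = a" using a unfolding fixed_points_def by auto
    have step: "\<exists>R x h. R \<ge> 2 ^ i \<and> x \<in> X \<and> h \<in> B (2 * R) \<and> dist x a < 1 / (real i + 1) \<and>
        (\<forall>g\<in>B R. dist (\<phi> g x) x \<le> 1) \<and> dist (\<phi> h x) x > 1" for i
    proof -
      \<comment> \<open>As \<open>a\<close> is fixed and \<open>F\<close> is uniformly continuous on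
        this compact set, all of \<open>B (2 ^ i)\<close> moves a point \<open>x\<close> near
        \<open>a\<close> to within 1/2 of \<open>a\<close>, which is itself within 1/2 of
        \<open>x\<close>.\<close>
      define K where "K = closure (B (2 ^ i)) \<times> cball a 1"
      have "compact K" unfolding K_def by (intro compact_Times) (auto simp: compact_closure bounded_B)
      then have "uniformly_continuous_on K F"
        using contF by (intro compact_uniformly_continuous) (auto intro: continuous_on_subset)
      then obtain \<delta> where \<delta>: "\<delta> > 0"
        "\<And>p q. p \<in> K \<Longrightarrow> q \<in> K \<Longrightarrow> dist p q < \<delta> \<Longrightarrow> dist (F p) (F q) < 1 / 2"
        unfolding uniformly_continuous_on_def by (meson half_gt_zero zero_less_one)
      define \<epsilon> where "\<epsilon> = min \<delta> (min (1 / 2) (1 / (real i + 1)))"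
      have "\<epsilon> > 0" using \<delta>(1) by (simp add: \<epsilon>_def)
      with acc obtain x where x: "x \<in> X" "dist x a < \<epsilon>" "x \<notin> fixed_points G X \<phi>" by blast
      have x_close: "dist x a < \<delta>" "dist x a < 1 / 2" "dist x a < 1 / (real i + 1)"
        using x(2) unfolding \<epsilon>_def by auto
      define P where "P j \<longleftrightarrow> (\<forall>g\<in>B (2 ^ j). dist (\<phi> g x) x \<le> 1)" for j
      have "P i" unfolding P_def
      proof
        fix g assume g: "g \<in> B (2 ^ i)"
        then have gG: "g \<in> G" unfolding B_def by blast
        have "(g, x) \<in> K" "(g, a) \<in> K"
          using g x_close closure_subset unfolding K_def by (auto simp: dist_commute)
        moreover have "dist (g, x) (g, a) < \<delta>" using x_close by (simp add: dist_Pair_Pair)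
        ultimately have "dist (\<phi> g x) (\<phi> g a) < 1 / 2"
          using \<delta>(2) act_F gG x(1) aX by metis
        then show "dist (\<phi> g x) x \<le> 1"
          using x_close(2) fixa[OF gG] dist_triangle[of "\<phi> g x" x a] by (simp add: dist_commute)
      qed
      from x(1,3) obtain g where "g \<in> G" "\<phi> g x \<noteq> x" unfolding fixed_points_def by blast
      from nonfixed_unbounded[OF x(1) this, of i] obtain j where j: "j \<ge> i" "\<not> P j"
        unfolding P_def by force
      \<comment> \<open>A dyadic radius for which the displacement bound holds, but fails after
        doubling.\<close>
      have "\<exists>j\<ge>i. P j \<and> \<not> P (Suc j)"
      proof (rule ccontr)
        assume "\<not> ?thesis"
        then have *: "P k \<Longrightarrow> P (Suc k)" if "k \<ge> i" for k using that by blast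
        from j(1) have "P j" by (induction rule: dec_induct) (use \<open>P i\<close> * in auto)
        with j(2) show False by blast
      qed
      then obtain k where k: "k \<ge> i" "P k" "\<not> P (Suc k)" by blast
      then obtain h where h: "h \<in> B (2 * 2 ^ k)" "dist (\<phi> h x) x > 1" unfolding P_def by force
      have "(2::real) ^ k \<ge> 2 ^ i" using k(1) by (intro power_increasing) auto
      with k(2) h x(1) x_close(3) show ?thesis unfolding P_def by blast
    qed
    \<comment> \<open>The case \<open>g = mat 1\<close> will yield \<open>rpow h u \<in> B R\<close>
      itself. The index shift by \<open>i0\<close> makes every radius at least
      \<open>R1\<close>.\<close>
    obtain c1 R1 where R1: "c1 > 0" "\<forall>R\<ge>R1. \<forall>h\<in>B (2 * R). \<forall>u s.
        \<bar>u\<bar> \<le> c \<longrightarrow> \<bar>s\<bar> \<le> c1 * R \<longrightarrow> rpow (mat 1) s ** rpow h u \<in> B R"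
      using c(2) one by blast
    obtain i0 where "R1 < 2 ^ i0" using real_arch_pow[of 2 R1] by auto
    have "\<exists>R x h. R \<ge> 2 ^ i \<and> R \<ge> R1 \<and> x \<in> X \<and> h \<in> B (2 * R) \<and> dist x a < 1 / (real i + 1) \<and>
        (\<forall>g\<in>B R. dist (\<phi> g x) x \<le> 1) \<and> dist (\<phi> h x) x > 1" for i
    proof -
      obtain R x h where *: "R \<ge> 2 ^ (i + i0)" "x \<in> X" "h \<in> B (2 * R)" "dist x a < 1 / (real (i + i0) + 1)"
        "\<forall>g\<in>B R. dist (\<phi> g x) x \<le> 1" "dist (\<phi> h x) x > 1" using step by blast
      have "(2::real) ^ i \<le> 2 ^ (i + i0)" "(2::real) ^ i0 \<le> 2 ^ (i + i0)"
        by (intro power_increasing; simp)+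
      moreover have "1 / (real (i + i0) + 1) \<le> 1 / (real i + 1)" by (intro divide_left_mono) auto
      ultimately have "R \<ge> 2 ^ i \<and> R \<ge> R1 \<and> dist x a < 1 / (real i + 1)"
        using *(1,4) \<open>R1 < 2 ^ i0\<close> by linarith
      with * show ?thesis by blast
    qed
    then obtain R x h where R: "\<And>i. R i \<ge> 2 ^ i" "\<And>i. R i \<ge> R1" and xX: "\<And>i. x i \<in> X"
      and h: "\<And>i. h i \<in> B (2 * R i)" and xa: "\<And>i. dist (x i) a < 1 / (real i + 1)"
      and small: "\<And>i g. g \<in> B (R i) \<Longrightarrow> dist (\<phi> g (x i)) (x i) \<le> 1"
      and large: "\<And>i. dist (\<phi> (h i) (x i)) (x i) > 1"
      by metis
    have hG: "h i \<in> G" for i using h unfolding B_def by blast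
    have x_lim: "x \<longlonglongrightarrow> a"
    proof (rule metric_LIMSEQ_I)
      fix e :: real assume "e > 0"
      then obtain n where "1 / (real n + 1) < e" using reals_Archimedean[of e] by (auto simp: inverse_eq_divide add.commute)
      moreover have "dist (x m) a < 1 / (real n + 1)" if "m \<ge> n" for m
      proof -
        have "1 / (real m + 1) \<le> 1 / (real n + 1)" using that by (intro divide_left_mono) auto
        with xa[of m] show ?thesis by linarith
      qed
      ultimately show "\<exists>n. \<forall>m\<ge>n. dist (x m) a < e" by (meson order.strict_trans)
    qed
    have R_lim: "filterlim R at_top sequentially"
    proof (rule filterlim_at_top_mono)
      show "filterlim real at_top sequentially" by (rule filterlim_real_sequentially)
      have "real i \<le> R i" for i
        using R(1)[of i] of_nat_less_two_power[of i, where 'a=real] by linarith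
      then show "\<forall>\<^sub>F i in sequentially. real i \<le> R i" by simp
    qed
    \<comment> \<open>One unit for the distance of \<open>x i\<close> from \<open>a\<close>, one for
      the displacement by \<open>B (R i)\<close>.\<close>
    define M where "M = norm a + 2"
    have small_norm: "norm (\<phi> g (x i)) \<le> M" if "g \<in> B (R i)" for g i
    proof -
      have "1 / (real i + 1) \<le> 1" by simp
      then have "dist (x i) a \<le> 1" using xa[of i] by linarith
      then show ?thesis
        using small[OF that] norm_triangle_sub[of "\<phi> g (x i)" "x i"] norm_triangle_sub[of "x i" a]
        by (simp add: M_def dist_norm)
    qed
    have "\<exists>c. \<forall>u. \<phi> (rpow (h i) u) (x i) = (\<Sum>k\<le>d. u ^ k *\<^sub>R c k)" for i
      using bspec[OF bspec[OF bspec[OF d xX] hG] one] by simp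
    then obtain cc where cc: "\<And>i u. \<phi> (rpow (h i) u) (x i) = (\<Sum>k\<le>d. u ^ k *\<^sub>R cc i k)" by metis
    obtain K1 where K1: "K1 \<ge> 0" "\<And>(c::nat \<Rightarrow> real^'n) M S. S > 0 \<Longrightarrow>
        (\<forall>t. \<bar>t\<bar> \<le> S \<longrightarrow> norm (\<Sum>k\<le>d. t ^ k *\<^sub>R c k) \<le> M) \<Longrightarrow> (\<forall>k\<le>d. S ^ k * norm (c k) \<le> K1 * M)"
      using coeff_bound_scaled[of d] by blast
    \<comment> \<open>The orbit curves are controlled for \<open>\<bar>u\<bar> \<le> c\<close>; as
      their degree is fixed, this already bounds all coefficients.\<close>
    have bounded_cc: "bounded (range (\<lambda>i. cc i k))" if "k < Suc d" for k
    proof -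
      have "norm (cc i k) \<le> K1 * M / c ^ k" for i
      proof -
        have "rpow (h i) u \<in> B (R i)" if u: "\<bar>u\<bar> \<le> c" for u
        proof -
          have "R i \<ge> 0" using R(1)[of i] by (meson order.trans zero_le_numeral zero_le_power)
          then have "\<bar>0\<bar> \<le> c1 * R i" using R1(1) by simp
          with R1(2) R(2)[of i] h[of i] u have "rpow (mat 1) 0 ** rpow (h i) u \<in> B (R i)" by blast
          then show ?thesis by (simp add: rpow_0)
        qed
        then have "\<forall>t. \<bar>t\<bar> \<le> c \<longrightarrow> norm (\<Sum>k\<le>d. t ^ k *\<^sub>R cc i k) \<le> M"
          using small_norm unfolding cc[symmetric] by blast
        from K1(2)[OF c(1) this] that have "c ^ k * norm (cc i k) \<le> K1 * M" by simp
        then show ?thesis using c(1) by (simp add: pos_le_divide_eq mult.commute)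
      qed
      then show ?thesis unfolding bounded_iff by blast
    qed
    obtain r where r: "strict_mono r" "\<forall>k<Suc d. \<exists>l. (\<lambda>j. cc (r j) k) \<longlonglongrightarrow> l"
      using finitely_many_convergent_subseq[of "Suc d" cc] bounded_cc by blast
    then obtain l where l: "\<And>k. k \<le> d \<Longrightarrow> (\<lambda>j. cc (r j) k) \<longlonglongrightarrow> l k"
      unfolding less_Suc_eq_le by metis
    define p where "p u = (\<Sum>k\<le>d. u ^ k *\<^sub>R l k)" for u :: real
    have lim: "(\<lambda>j. \<phi> (rpow (h (r j)) u) (x (r j))) \<longlonglongrightarrow> p u" for u
      unfolding cc p_def by (intro tendsto_intros l) simp
    have xr: "(\<lambda>j. x (r j)) \<longlonglongrightarrow> a"
      using LIMSEQ_subseq_LIMSEQ[OF x_lim r(1)] by (simp add: o_def)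
    have Rr: "filterlim (\<lambda>j. R (r j)) at_top sequentially"
      using filterlim_compose[OF R_lim filterlim_subseq[OF r(1)]] .
    have p0: "p 0 = a"
      using LIMSEQ_unique[OF lim[of 0]] xr by (simp add: rpow_0 act_one xX)
    \<comment> \<open>The parameter 1 may lie outside the interval of control. Convergence of the
      coefficients gives the limit there too, and \<open>large\<close> keeps it away from
      \<open>a\<close>.\<close>
    have dist_lim: "(\<lambda>j. dist (\<phi> (rpow (h (r j)) 1) (x (r j))) (x (r j))) \<longlonglongrightarrow> dist (p 1) a"
      by (intro tendsto_dist lim xr)
    have "1 \<le> dist (\<phi> (rpow (h (r j)) 1) (x (r j))) (x (r j))" for j
      using large[of "r j"] by (simp add: rpow_1 hG)
    then have "1 \<le> dist (p 1) a" by (intro LIMSEQ_le_const[OF dist_lim]) blast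
    then have p1: "p 1 \<noteq> a" by auto
    have pX: "p u \<in> X" for u
      using closed_sequentially[OF closed_X _ lim[of u]] act_closed rpow_in_G hG xX by blast
    obtain K2 where K2: "K2 \<ge> 0" "\<And>(c::nat \<Rightarrow> real^'n) M S. S \<ge> 1 \<Longrightarrow>
       (\<forall>t. \<bar>t\<bar> \<le> S \<longrightarrow> norm (\<Sum>k\<le>d. t ^ k *\<^sub>R c k) \<le> M) \<Longrightarrow> norm ((\<Sum>k\<le>d. c k) - c 0) \<le> K2 * M / S"
      using bounded_poly_increment[of d] by blast
    have inv_small: "F (g, p u) = p u" if g: "g \<in> G" and u: "\<bar>u\<bar> \<le> c" for g u
    proof -
      obtain c2 R2 where R2: "c2 > 0" "\<forall>R\<ge>R2. \<forall>h\<in>B (2 * R). \<forall>u s.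
        \<bar>u\<bar> \<le> c \<longrightarrow> \<bar>s\<bar> \<le> c2 * R \<longrightarrow> rpow g s ** rpow h u \<in> B R"
        using c(2) g by blast
      define y where "y j = \<phi> (rpow (h (r j)) u) (x (r j))" for j
      have y_lim: "y \<longlonglongrightarrow> p u" unfolding y_def by (rule lim)
      have y: "y j \<in> X" for j unfolding y_def using act_closed rpow_in_G hG xX by blast
      \<comment> \<open>For \<open>\<bar>s\<bar> \<le> c2 * R (r j)\<close> the product
        \<open>rpow g s ** rpow (h (r j)) u\<close> stays in \<open>B (R (r j))\<close>, so the
        curve \<open>s \<mapsto> g^s (y j)\<close> has norm at most \<open>M\<close> on an interval
        whose length grows with \<open>R\<close>.\<close>
      have bound: "norm (\<phi> g (y j) - y j) \<le> K2 * M / (c2 * R (r j))"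
        if j: "R (r j) \<ge> R2" "R (r j) \<ge> 1 / c2" for j
      proof -
        have hu: "rpow (h (r j)) u \<in> G" by (intro rpow_in_G hG)
        from d xX g hu obtain q where
          q: "\<And>s. \<phi> (rpow g s ** rpow (h (r j)) u) (x (r j)) = (\<Sum>k\<le>d. s ^ k *\<^sub>R q k)"
          by metis
        have "(\<Sum>k\<le>d. q k) = \<phi> g (y j)"
          using q[of 1] rpow_1[OF g] act_mult[OF g hu xX] by (simp add: y_def)
        moreover have "(\<Sum>k\<le>d. 0 ^ k *\<^sub>R q k) = (\<Sum>k\<in>{0}. q k)" by (rule sum.mono_neutral_cong_right) auto
        then have "q 0 = y j" using q[of 0] by (simp add: y_def rpow_0)
        moreover have "\<forall>t. \<bar>t\<bar> \<le> c2 * R (r j) \<longrightarrow> norm (\<Sum>k\<le>d. t ^ k *\<^sub>R q k) \<le> M"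
          unfolding q[symmetric] using R2(2) j(1) h u small_norm by blast
        moreover have "1 \<le> c2 * R (r j)" using j(2) R2(1) by (simp add: pos_divide_le_eq mult.commute)
        ultimately show ?thesis using K2(2)[of "c2 * R (r j)" q M] by simp
      qed
      have "\<forall>\<^sub>F j in sequentially. R (r j) \<ge> R2" "\<forall>\<^sub>F j in sequentially. R (r j) \<ge> 1 / c2"
        using Rr unfolding filterlim_at_top by blast+
      then have "\<forall>\<^sub>F j in sequentially. norm (\<phi> g (y j) - y j) \<le> K2 * M / (c2 * R (r j))"
        by eventually_elim (rule bound)
      moreover have "(\<lambda>j. K2 * M / (c2 * R (r j))) \<longlonglongrightarrow> 0"
        by (intro tendsto_divide_0[OF tendsto_const] filterlim_at_top_imp_at_infinity
              filterlim_tendsto_pos_mult_at_top[OF tendsto_const R2(1)] Rr)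
      ultimately have "(\<lambda>j. \<phi> g (y j) - y j) \<longlonglongrightarrow> 0" by (rule Lim_null_comparison)
      from tendsto_add[OF this y_lim] have "(\<lambda>j. F (g, y j)) \<longlonglongrightarrow> p u"
        using act_F[OF g y] by simp
      moreover have "(\<lambda>j. F (g, y j)) \<longlonglongrightarrow> F (g, p u)"
        using contF by (intro continuous_on_tendsto_compose[of UNIV F] tendsto_Pair tendsto_const y_lim) auto
      ultimately show ?thesis by (rule LIMSEQ_unique[symmetric])
    qed
    \<comment> \<open>So far invariance is known for \<open>\<bar>u\<bar> \<le> c\<close>. Both
      sides are polynomial in \<open>u\<close>, which extends it to all parameters.\<close>
    have "F (g, p u) $ i - p u $ i = 0" if g: "g \<in> G" for g u i
    proof -
      have pc: "poly_curve d p" unfolding p_def by (rule poly_curve_monomial_sum)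
      have "real_polynomial_function (\<lambda>z. F z $ i)"
        using polynomial_F bounded_linear_vec_nth[of i] unfolding polynomial_function_def o_def by blast
      from poly_fun_real_polynomial_compose[OF this, of d] poly_curve_Pair[OF poly_curve_const pc]
      obtain e where e: "poly_fun e (\<lambda>u. F (g, p u) $ i)" by metis
      have "poly_fun d (\<lambda>u. p u $ i)"
        using pc bounded_linear_vec_nth[of i] unfolding poly_curve_def by blast
      from poly_fun_mult[OF poly_fun_const[of 0 "-1"] this]
      have "poly_fun d (\<lambda>u. - 1 * p u $ i)" by (simp only: add_0)
      from poly_fun_add[OF poly_fun_mono[OF e max.cobounded1] poly_fun_mono[OF this max.cobounded2]]
      have "poly_fun (max e d) (\<lambda>u. F (g, p u) $ i + - 1 * p u $ i)" .
      from poly_fun_zero_on_interval[OF this c(1), of u] inv_small[OF g] show ?thesis by simp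
    qed
    then have "F (g, p u) = p u" if "g \<in> G" for g u using that by (simp add: vec_eq_iff)
    then have "p u \<in> fixed_points G X \<phi>" for u
      unfolding fixed_points_def using pX act_F by simp
    with p0 p1 show ?thesis unfolding p_def by blast
  qed
  then show ?thesis by (intro exI[of _ d] ballI impI)
qed

end

section \<open>The identity theorem on smooth real algebraic sets\<close>

definition cvec :: "real^'n \<Rightarrow> complex^'n" where
  "cvec x = (\<chi> i. of_real (x $ i))"

definition cconj :: "complex^'n \<Rightarrow> complex^'n" where
  "cconj z = (\<chi> i. cnj (z $ i))"

lemma norm_cvec: "norm (cvec x) = norm x"
  by (simp add: cvec_def norm_vec_def)

lemma cvec_diff: "cvec x - cvec y = cvec (x - y)"
  by (simp add: cvec_def vec_eq_iff)

lemma dist_cvec: "dist (cvec x) (cvec y) = dist x y"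
  by (simp add: dist_norm cvec_diff norm_cvec)

lemma linear_cvec: "linear cvec"
  by (auto intro!: linearI simp: cvec_def vec_eq_iff scaleR_conv_of_real[where 'a=complex])

lemma has_derivative_cvec: "(cvec has_derivative cvec) (at x)"
  by (rule bounded_linear_imp_has_derivative) (rule linear_cvec[unfolded linear_conv_bounded_linear])

lemma continuous_on_cvec: "continuous_on S cvec"
  by (rule linear_continuous_on) (rule linear_cvec[unfolded linear_conv_bounded_linear])

lemma dist_cconj: "dist (cconj z) (cvec x) = dist z (cvec x)"
proof -
  have "norm (cnj a - of_real t) = norm (a - of_real t)" for a t
    by (metis complex_cnj_complex_of_real complex_cnj_diff complex_mod_cnj)
  then show ?thesis by (simp add: dist_norm norm_vec_def cconj_def cvec_def)
qed

lemma cconj_fixed: "cconj z = z \<Longrightarrow> \<exists>x. z = cvec x"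
proof -
  assume "cconj z = z"
  then have "cnj (z $ i) = z $ i" for i by (metis cconj_def vec_lambda_beta)
  then have "z $ i = of_real (Re (z $ i))" for i
    by (metis Reals_cnj_iff of_real_Re)
  then have "z = cvec (\<chi> i. Re (z $ i))" by (simp add: cvec_def vec_eq_iff)
  then show ?thesis ..
qed

lemma cconj_cvec: "cconj (cvec x) = cvec x"
  by (simp add: cconj_def cvec_def vec_eq_iff)

text \<open>\<open>P\<close> is the holomorphic extension of \<open>p\<close>: the complex
  coefficients \<open>D i\<close> make the derivative complex linear. Compatibility with conjugation
  will show that real coordinates belong to real points.\<close>

definition complexifies ::
    "(complex^'n \<Rightarrow> complex) \<Rightarrow> ('n \<Rightarrow> complex^'n \<Rightarrow> complex) \<Rightarrow> (real^'n \<Rightarrow> real) \<Rightarrow> bool" where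
  "complexifies P D p \<longleftrightarrow> (\<forall>x. P (cvec x) = of_real (p x)) \<and> (\<forall>z. P (cconj z) = cnj (P z)) \<and>
     (\<forall>i. continuous_on UNIV (D i)) \<and> (\<forall>z. (P has_derivative (\<lambda>v. \<Sum>i\<in>UNIV. D i z * v $ i)) (at z))"

lemma complexifies_continuous:
  assumes "complexifies P D p" shows "continuous_on UNIV P"
proof (rule continuous_at_imp_continuous_on, rule ballI)
  fix z
  have "(P has_derivative (\<lambda>v. \<Sum>i\<in>UNIV. D i z * v $ i)) (at z)"
    using assms unfolding complexifies_def by blast
  then show "isCont P z" by (rule has_derivative_continuous)
qed

lemma complexification_exists:
  assumes "real_polynomial_function (p :: real^'n \<Rightarrow> real)"
  shows "\<exists>P D. complexifies P D p"
  using assms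
proof induction
  case (linear f)
  define P where "P z = (\<Sum>i\<in>UNIV. of_real (f (axis i 1)) * z $ i)" for z :: "complex^'n"
  have lin: "linear P"
    unfolding P_def by (auto intro!: linearI simp: algebra_simps sum.distrib scaleR_sum_right)
  have f: "f x = (\<Sum>i\<in>UNIV. f (axis i 1) * x $ i)" for x
  proof -
    have "f x = f (\<Sum>i\<in>UNIV. x $ i *\<^sub>R axis i 1)"
      by (metis (mono_tags, lifting) basis_expansion scalar_mult_eq_scaleR sum.cong)
    also have "\<dots> = (\<Sum>i\<in>UNIV. f (axis i 1) * x $ i)"
      using bounded_linear.linear[OF linear] by (simp add: linear_sum linear_scale mult.commute)
    finally show ?thesis .
  qed
  have "complexifies P (\<lambda>i z. of_real (f (axis i 1))) f"
    unfolding complexifies_def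
  proof (intro conjI allI)
    show "P (cvec x) = of_real (f x)" for x by (simp add: P_def cvec_def f[of x])
    show "P (cconj z) = cnj (P z)" for z by (simp add: P_def cconj_def)
    show "(P has_derivative (\<lambda>v. \<Sum>i\<in>UNIV. of_real (f (axis i 1)) * v $ i)) (at z)" for z
      using bounded_linear_imp_has_derivative[of P] lin linear_conv_bounded_linear
      unfolding P_def by blast
  qed simp
  then show ?case by blast
next
  case (const c)
  have "complexifies (\<lambda>z. of_real c) (\<lambda>i z. 0) (\<lambda>x::real^'n. c)"
    by (simp add: complexifies_def)
  then show ?case by blast
next
  case (add f g)
  then obtain P D Q E where PQ: "complexifies P D f" "complexifies Q E g" by blast
  have "complexifies (\<lambda>z. P z + Q z) (\<lambda>i z. D i z + E i z) (\<lambda>x. f x + g x)"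
    unfolding complexifies_def
  proof (intro conjI allI)
    show "((\<lambda>z. P z + Q z) has_derivative (\<lambda>v. \<Sum>i\<in>UNIV. (D i z + E i z) * v $ i)) (at z)" for z
      using PQ unfolding complexifies_def
      by (auto intro!: derivative_eq_intros simp: sum.distrib distrib_right)
  qed (use PQ in \<open>auto simp: complexifies_def intro!: continuous_intros\<close>)
  then show ?case by blast
next
  case (mult f g)
  then obtain P D Q E where PQ: "complexifies P D f" "complexifies Q E g" by blast
  have "complexifies (\<lambda>z. P z * Q z) (\<lambda>i z. P z * E i z + D i z * Q z) (\<lambda>x. f x * g x)"
    unfolding complexifies_def
  proof (intro conjI allI)
    show "((\<lambda>z. P z * Q z) has_derivative (\<lambda>v. \<Sum>i\<in>UNIV. (P z * E i z + D i z * Q z) * v $ i)) (at z)" for z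
    proof -
      have 1: "(P has_derivative (\<lambda>v. \<Sum>i\<in>UNIV. D i z * v $ i)) (at z)"
        "(Q has_derivative (\<lambda>v. \<Sum>i\<in>UNIV. E i z * v $ i)) (at z)"
        using PQ unfolding complexifies_def by blast+
      have eq: "P z * (\<Sum>i\<in>UNIV. E i z * v $ i) + (\<Sum>i\<in>UNIV. D i z * v $ i) * Q z =
          (\<Sum>i\<in>UNIV. (P z * E i z + D i z * Q z) * v $ i)" for v
        by (simp add: sum_distrib_left sum_distrib_right sum.distrib[symmetric] algebra_simps)
      from has_derivative_mult[OF 1] show ?thesis unfolding eq .
    qed
    show "continuous_on UNIV (\<lambda>z. P z * E i z + D i z * Q z)" for i
      using PQ complexifies_continuous[OF PQ(1)] complexifies_continuous[OF PQ(2)]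
      by (auto simp: complexifies_def intro!: continuous_intros)
  qed (use PQ in \<open>auto simp: complexifies_def\<close>)
  then show ?case by blast
qed

lemma complexifies_gradient:
  assumes P: "complexifies P D p" and grad: "GDERIV p b :> e"
  shows "D i (cvec b) = of_real (e $ i)"
proof -
  have eq: "(\<lambda>x. P (cvec x)) = (\<lambda>x. of_real (p x))" using P unfolding complexifies_def by blast
  have "(P has_derivative (\<lambda>v. \<Sum>i\<in>UNIV. D i (cvec b) * v $ i)) (at (cvec b))"
    using P unfolding complexifies_def by blast
  from has_derivative_compose[OF has_derivative_cvec this]
  have 1: "((\<lambda>x. of_real (p x)) has_derivative (\<lambda>v. \<Sum>i\<in>UNIV. D i (cvec b) * (cvec v) $ i)) (at b)"
    unfolding eq .
  have 2: "((\<lambda>x. of_real (p x) :: complex) has_derivative (\<lambda>v. of_real (v \<bullet> e))) (at b)"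
    using grad unfolding gderiv_def by (rule has_derivative_of_real)
  from has_derivative_unique[OF 1 2]
  have "(\<lambda>v. \<Sum>i\<in>UNIV. D i (cvec b) * (cvec v) $ i) = (\<lambda>v. of_real (v \<bullet> e))" .
  from fun_cong[OF this, of "axis i 1"]
  have "(\<Sum>j\<in>UNIV. D j (cvec b) * (cvec (axis i 1)) $ j) = of_real (e $ i)"
    by (simp add: inner_axis' )
  moreover have "(\<Sum>j\<in>UNIV. D j (cvec b) * (cvec (axis i 1)) $ j) = (\<Sum>j\<in>UNIV. if j = i then D j (cvec b) else 0)"
    by (intro sum.cong) (auto simp: cvec_def axis_def)
  ultimately show ?thesis by simp
qed

text \<open>
  The complexified coordinates are inverted by a function \<open>g\<close> which is holomorphic on complex lines
  and, by uniqueness, maps real points to real points.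
\<close>

lemma zero_propagates_in_coordinates:
  fixes q :: "'n::finite \<Rightarrow> real^'n \<Rightarrow> real" and e :: "'n \<Rightarrow> real^'n"
  assumes q: "\<And>j. real_polynomial_function (q j)" "\<And>j. GDERIV (q j) b :> e j"
    and e: "\<And>v. (\<And>j. v \<bullet> e j = 0) \<Longrightarrow> v = 0"
    and U: "open U" "b \<in> U"
    and X: "\<And>x. x \<in> U \<Longrightarrow> x \<in> X \<longleftrightarrow> (\<forall>j\<in>J. q j x = 0)"
  shows "\<exists>V. open V \<and> b \<in> V \<and> (\<forall>f x y \<epsilon>. real_polynomial_function f \<longrightarrow> x \<in> X \<inter> V \<longrightarrow> y \<in> X \<inter> V \<longrightarrow>
    \<epsilon> > 0 \<longrightarrow> (\<forall>z\<in>X. dist z x < \<epsilon> \<longrightarrow> f z = 0) \<longrightarrow> f y = (0::real))"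
proof -
  obtain Q D where QD: "\<And>j. complexifies (Q j) (D j) (q j)"
    using complexification_exists[OF q(1)] by metis
  define \<Phi> where "\<Phi> z = (\<chi> j. Q j z)" for z
  define L where "L z v = (\<chi> j. \<Sum>i\<in>UNIV. D j i z * v $ i)" for z v
  have der: "(\<Phi> has_derivative L z) (at z)" for z
  proof (rule iffD2[OF has_derivative_componentwise_within], rule ballI)
    fix u :: "complex^'n" assume "u \<in> Basis"
    then obtain j c where u: "u = axis j c" unfolding Basis_vec_def by blast
    have "(Q j has_derivative (\<lambda>v. \<Sum>i\<in>UNIV. D j i z * v $ i)) (at z)"
      using QD[of j] unfolding complexifies_def by blast
    from has_derivative_inner_left[OF this, of c]
    show "((\<lambda>z. \<Phi> z \<bullet> u) has_derivative (\<lambda>v. L z v \<bullet> u)) (at z)"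
      by (simp add: u inner_axis \<Phi>_def L_def)
  qed
  have blin: "bounded_linear (L z)" for z using der by (rule has_derivative_bounded_linear)
  define f' where "f' z = Blinfun (L z)" for z
  have f': "blinfun_apply (f' z) = L z" for z by (simp add: f'_def bounded_linear_Blinfun_apply blin)
  have L_hom: "L z (c *s v) = c *s L z v" for z c v
    by (simp add: L_def vec_eq_iff sum_distrib_left algebra_simps)
  have contL: "continuous_on UNIV (\<lambda>z. L z v)" for v
  proof -
    have "continuous_on UNIV (D j i)" for j i using QD[of j] unfolding complexifies_def by blast
    then show ?thesis unfolding L_def by (intro continuous_intros)
  qed
  have contf': "continuous_on UNIV f'"
    unfolding continuous_on_eq_continuous_within
    by (intro ballI continuous_blinfun_componentwiseI1)
       (use contL in \<open>simp add: f' continuous_on_eq_continuous_within\<close>)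
  \<comment> \<open>Real and imaginary parts of a kernel vector are both orthogonal to all gradients
    \<open>e j\<close>, hence zero.\<close>
  have ker: "v = 0" if v: "L (cvec b) v = 0" for v
  proof -
    have *: "(\<Sum>i\<in>UNIV. of_real (e j $ i) * v $ i) = 0" for j
      using v complexifies_gradient[OF QD q(2)] by (simp add: L_def vec_eq_iff)
    have "(\<chi> i. Re (v $ i)) \<bullet> e j = Re (\<Sum>i\<in>UNIV. of_real (e j $ i) * v $ i)"
      "(\<chi> i. Im (v $ i)) \<bullet> e j = Im (\<Sum>i\<in>UNIV. of_real (e j $ i) * v $ i)" for j
      by (simp_all add: inner_vec_def mult.commute)
    then have "(\<chi> i. Re (v $ i)) = 0" "(\<chi> i. Im (v $ i)) = 0" using e * by simp_all
    then show "v = 0" by (simp add: vec_eq_iff complex_eq_iff)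
  qed
  have lin: "linear (L (cvec b))" using blin by (rule bounded_linear.linear)
  have "inj (L (cvec b))" using ker linear_injective_0[OF lin] by blast
  from linear_injective_left_inverse[OF lin this] obtain g0
    where g0: "linear g0" "g0 \<circ> L (cvec b) = id" by blast
  have left_inv: "Blinfun g0 o\<^sub>L f' (cvec b) = id_blinfun"
  proof (rule blinfun_eqI)
    fix v
    have "g0 (L (cvec b) v) = v" using g0(2) by (metis comp_apply id_apply)
    then show "blinfun_apply (Blinfun g0 o\<^sub>L f' (cvec b)) v = blinfun_apply id_blinfun v"
      using g0(1) by (simp add: f' bounded_linear_Blinfun_apply linear_conv_bounded_linear)
  qed
  have "\<exists>U' V g g'. open U' \<and> cvec b \<in> U' \<and> open V \<and> \<Phi> (cvec b) \<in> V \<and> homeomorphism U' V \<Phi> g \<and>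
      (\<forall>w\<in>V. (g has_derivative (g' w)) (at w) \<and> g' w = inv_into UNIV (L (g w)) \<and> bij (L (g w)))"
  proof (rule inverse_function_theorem[OF open_UNIV _ contf' UNIV_I left_inv])
    show "(\<Phi> has_derivative blinfun_apply (f' z)) (at z)" for z unfolding f' by (rule der)
  qed (unfold f', blast)
  then obtain U' V g g' where inv: "open U'" "cvec b \<in> U'" "open V" "\<Phi> (cvec b) \<in> V" "homeomorphism U' V \<Phi> g"
    and g: "\<And>w. w \<in> V \<Longrightarrow> (g has_derivative (g' w)) (at w)"
      "\<And>w. w \<in> V \<Longrightarrow> g' w = inv_into UNIV (L (g w))" "\<And>w. w \<in> V \<Longrightarrow> bij (L (g w))"
    by blast
  have gU: "g w \<in> U'" "\<Phi> (g w) = w" if "w \<in> V" for w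
    using inv(5) that unfolding homeomorphism_def by auto
  have gPhi: "g (\<Phi> z) = z" "\<Phi> z \<in> V" if "z \<in> U'" for z
    using inv(5) that unfolding homeomorphism_def by auto
  obtain r1 where r1: "r1 > 0" "ball (cvec b) r1 \<subseteq> U'" using inv(1,2) open_contains_ball by blast
  obtain r2 where r2: "r2 > 0" "ball b r2 \<subseteq> U" using U open_contains_ball by blast
  \<comment> \<open>A ball around the real point \<open>cvec b\<close> is stable under conjugation;
    its radius is at most \<open>r2\<close>, so the real points in it come from
    \<open>U\<close>.\<close>
  define O' where "O' = ball (cvec b) (min r1 r2)"
  have O': "open O'" "O' \<subseteq> U'" "cvec b \<in> O'" using r1 r2 unfolding O'_def by auto
  have O'U: "x \<in> U" if "cvec x \<in> O'" for x
    using that r2(2) unfolding O'_def by (auto simp: dist_cvec)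
  have O'conj: "cconj z \<in> O'" if "z \<in> O'" for z
    using that dist_cconj[of z b] unfolding O'_def by (simp add: dist_commute)
  have contg: "continuous_on V g" using inv(5) unfolding homeomorphism_def by blast
  have "open (V \<inter> g -` O')" using contg inv(3) O'(1) by (simp add: continuous_open_preimage)
  moreover have "\<Phi> (cvec b) \<in> V \<inter> g -` O'" using inv(4) gPhi(1)[OF inv(2)] O'(3) by simp
  ultimately obtain \<rho> where \<rho>: "\<rho> > 0" "ball (\<Phi> (cvec b)) \<rho> \<subseteq> V \<inter> g -` O'"
    using open_contains_ball by blast
  define W where "W = ball (\<Phi> (cvec b)) \<rho>"
  have W: "w \<in> V" "g w \<in> O'" if "w \<in> W" for w using that \<rho>(2) unfolding W_def by auto
  have Phi_real: "\<Phi> (cvec x) = cvec (\<chi> j. q j x)" for x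
    using QD unfolding \<Phi>_def by (simp add: complexifies_def cvec_def vec_eq_iff)
  have Phi_conj: "\<Phi> (cconj z) = cconj (\<Phi> z)" for z
    using QD unfolding \<Phi>_def by (simp add: complexifies_def cconj_def vec_eq_iff)
  \<comment> \<open>\<open>g (cvec y)\<close> and its conjugate have the same image under
    \<open>\<Phi>\<close> and both lie in \<open>U'\<close>, where \<open>\<Phi>\<close> is
    injective, so they agree.\<close>
  have g_real: "\<exists>x\<in>U. g (cvec y) = cvec x \<and> (\<forall>j. q j x = y $ j)" if y: "cvec y \<in> W" for y
  proof -
    have "\<Phi> (cconj (g (cvec y))) = cvec y"
      using gU(2)[OF W(1)[OF y]] by (simp add: Phi_conj cconj_cvec)
    then have "cconj (g (cvec y)) = g (cvec y)"
      using gPhi(1)[of "cconj (g (cvec y))"] O'conj[OF W(2)[OF y]] O'(2) by auto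
    then obtain x where x: "g (cvec y) = cvec x" using cconj_fixed by blast
    have "x \<in> U" using O'U W(2)[OF y] x by simp
    moreover have "cvec (\<chi> j. q j x) = cvec y" using gU(2)[OF W(1)[OF y]] x Phi_real by simp
    then have "q j x = y $ j" for j by (simp add: cvec_def vec_eq_iff)
    ultimately show ?thesis using x by blast
  qed
  have contPhi: "continuous_on UNIV \<Phi>"
    using der by (meson continuous_at_imp_continuous_on has_derivative_continuous)
  define V0 where "V0 = cvec -` (O' \<inter> \<Phi> -` W)"
  have "open (\<Phi> -` W)" using contPhi unfolding W_def by (simp add: open_vimage continuous_on_eq_continuous_at)
  then have "open V0"
    unfolding V0_def using O'(1) continuous_on_cvec[of UNIV]
    by (intro open_vimage) (auto simp: open_Int)
  moreover have "b \<in> V0" unfolding V0_def W_def using O'(3) \<rho>(1) by simp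
  moreover have "f y = 0" if f: "real_polynomial_function f" and x: "x \<in> X \<inter> V0" and y: "y \<in> X \<inter> V0"
    and \<epsilon>: "\<epsilon> > 0" "\<forall>z\<in>X. dist z x < \<epsilon> \<longrightarrow> f z = 0" for f x y \<epsilon>
  proof -
    obtain P E where PE: "complexifies P E f" using complexification_exists[OF f] by blast
    have xU: "x \<in> U" "y \<in> U" using x y O'U unfolding V0_def by auto
    define \<xi> where "\<xi> = (\<chi> j. q j x)"
    define \<eta> where "\<eta> = (\<chi> j. q j y) - \<xi>"
    \<comment> \<open>The complex line through the coordinates of \<open>x\<close> (at 0) and of
      \<open>y\<close> (at 1). The coordinates in \<open>J\<close> vanish at both ends, hence on the
      whole line, so its real points in the domain \<open>T\<close> pull back to points of
      \<open>X\<close>.\<close>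
    define \<psi> where "\<psi> t = cvec \<xi> + t *s cvec \<eta>" for t :: complex
    define T where "T = \<psi> -` W"
    have \<psi>0: "\<psi> 0 = \<Phi> (cvec x)" by (simp add: \<psi>_def \<xi>_def Phi_real)
    have \<psi>1: "\<psi> 1 = \<Phi> (cvec y)"
      by (simp add: \<psi>_def \<eta>_def \<xi>_def Phi_real cvec_diff[symmetric])
    have \<psi>_real: "\<psi> (of_real t) = cvec (\<xi> + t *\<^sub>R \<eta>)" for t
      by (simp add: \<psi>_def cvec_def vec_eq_iff)
    have lin_s: "linear (\<lambda>t. t *s cvec \<eta>)"
      by (auto intro!: linearI simp: vec_eq_iff algebra_simps)
    have \<psi>_der: "(\<psi> has_derivative (\<lambda>t. t *s cvec \<eta>)) (at t)" for t
    proof -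
      have "((\<lambda>t. t *s cvec \<eta>) has_derivative (\<lambda>t. t *s cvec \<eta>)) (at t)"
        using lin_s by (intro bounded_linear_imp_has_derivative) (simp add: linear_conv_bounded_linear)
      from has_derivative_add[OF has_derivative_const this] show ?thesis unfolding \<psi>_def by simp
    qed
    have cont\<psi>: "continuous_on UNIV \<psi>"
      using \<psi>_der by (meson continuous_at_imp_continuous_on has_derivative_continuous)
    have "open T" unfolding T_def W_def using cont\<psi> by (intro open_vimage) auto
    \<comment> \<open>\<open>T\<close> is the preimage of a ball under an affine map. Convexity
      makes it connected, as analytic continuation from 0 to 1 requires.\<close>
    have "convex T"
    proof (rule convexI)
      fix s t u v assume st: "s \<in> T" "t \<in> T" "0 \<le> u" "0 \<le> v" "u + v = (1::real)"
      have "\<psi> (u *\<^sub>R s + v *\<^sub>R t) = (u + v) *\<^sub>R cvec \<xi> + (u *\<^sub>R s + v *\<^sub>R t) *s cvec \<eta>"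
        by (simp add: \<psi>_def st(5))
      also have "\<dots> = u *\<^sub>R \<psi> s + v *\<^sub>R \<psi> t"
        by (simp add: \<psi>_def vec_eq_iff algebra_simps)
      finally show "u *\<^sub>R s + v *\<^sub>R t \<in> T"
        using st convexD[OF convex_ball[of "\<Phi> (cvec b)" \<rho>]] unfolding T_def W_def by simp
    qed
    have T01: "0 \<in> T" "1 \<in> T" using x y \<psi>0 \<psi>1 unfolding T_def V0_def by auto
    define h where "h t = P (g (\<psi> t))" for t
    have "h field_differentiable (at t)" if t: "t \<in> T" for t
    proof -
      define z where "z = g (\<psi> t)"
      have tV: "\<psi> t \<in> V" using W(1) t unfolding T_def by blast
      \<comment> \<open>The inverse of the complex linear map \<open>L z\<close> is complex linear;
        thereby the derivative of \<open>h\<close> is multiplication by a complex number and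
        \<open>h\<close> is holomorphic.\<close>
      have gh: "g' (\<psi> t) (c *s w) = c *s g' (\<psi> t) w" for c w
      proof -
        have L_inv: "L z (inv_into UNIV (L z) w) = w" for w
          using g(3)[OF tV] unfolding z_def by (meson bij_is_surj surj_f_inv_f)
        have "L z (c *s inv_into UNIV (L z) w) = c *s w" by (simp add: L_hom L_inv)
        then have "inv_into UNIV (L z) (c *s w) = c *s inv_into UNIV (L z) w"
          using g(3)[OF tV] unfolding z_def by (metis bij_inv_eq_iff)
        then show ?thesis using g(2)[OF tV] by (simp add: z_def)
      qed
      have "(P has_derivative (\<lambda>v. \<Sum>i\<in>UNIV. E i z * v $ i)) (at z)"
        using PE by (simp add: complexifies_def)
      then have "(h has_derivative (\<lambda>s. \<Sum>i\<in>UNIV. E i z * (g' (\<psi> t) (s *s cvec \<eta>)) $ i)) (at t)"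
        unfolding h_def z_def
        by (intro has_derivative_compose[where f="\<lambda>t. g (\<psi> t)" and g=P]
            has_derivative_compose[OF \<psi>_der g(1)[OF tV]])
      moreover have "(\<lambda>s. \<Sum>i\<in>UNIV. E i z * (g' (\<psi> t) (s *s cvec \<eta>)) $ i)
          = (*) (\<Sum>i\<in>UNIV. E i z * (g' (\<psi> t) (cvec \<eta>)) $ i)"
        by (auto simp: gh sum_distrib_left sum_distrib_right mult_ac)
      ultimately show ?thesis unfolding field_differentiable_def has_field_derivative_def by metis
    qed
    then have hol: "h holomorphic_on T"
      unfolding holomorphic_on_def using field_differentiable_at_within by blast
    have real_pt: "\<exists>w\<in>X. g (\<psi> (of_real t)) = cvec w" if t: "of_real t \<in> T" for t
    proof -
      obtain w where w: "w \<in> U" "g (\<psi> (of_real t)) = cvec w" "\<And>j. q j w = (\<xi> + t *\<^sub>R \<eta>) $ j"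
        using g_real[of "\<xi> + t *\<^sub>R \<eta>"] t \<psi>_real unfolding T_def by auto
      have "q j w = 0" if "j \<in> J" for j
        using w(3)[of j] X[OF xU(1)] X[OF xU(2)] x y that by (simp add: \<xi>_def \<eta>_def)
      then have "w \<in> X" using X[OF w(1)] by blast
      with w(2) show ?thesis by blast
    qed
    have g0: "g (\<psi> 0) = cvec x" using gPhi(1) x O'(2) unfolding \<psi>0 V0_def by auto
    have "isCont (\<lambda>t. g (\<psi> t)) 0"
    proof -
      have "isCont g (\<psi> 0)"
        using contg inv(3) W(1) T01(1) unfolding T_def by (simp add: continuous_on_eq_continuous_at)
      moreover have "isCont \<psi> 0" using cont\<psi> by (simp add: continuous_on_eq_continuous_at)
      ultimately show ?thesis using isCont_o2 by blast
    qed
    then obtain \<delta>1 where \<delta>1: "\<delta>1 > 0" "\<And>t. dist t 0 < \<delta>1 \<Longrightarrow> dist (g (\<psi> t)) (cvec x) < \<epsilon>"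
      unfolding continuous_at_eps_delta g0 using \<epsilon>(1) by blast
    obtain \<delta>2 where \<delta>2: "\<delta>2 > 0" "ball 0 \<delta>2 \<subseteq> T" using \<open>open T\<close> T01(1) open_contains_ball by blast
    \<comment> \<open>Small real parameters give points of \<open>X\<close> within
      \<open>\<epsilon>\<close> of \<open>x\<close>, where \<open>f\<close> vanishes.\<close>
    define Z where "Z = complex_of_real ` {t. 0 < t \<and> t < min \<delta>1 \<delta>2}"
    have ZT: "Z \<subseteq> T" using \<delta>2(2) unfolding Z_def by (auto simp: subset_iff dist_norm)
    have "h z = 0" if z: "z \<in> Z" for z
    proof -
      obtain t where t: "z = of_real t" "0 < t" "t < \<delta>1" using z unfolding Z_def by auto
      obtain w where w: "w \<in> X" "g (\<psi> z) = cvec w" using real_pt ZT z t(1) by blast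
      have "dist w x < \<epsilon>" using \<delta>1(2)[of z] t w(2) by (simp add: dist_norm dist_cvec[unfolded dist_norm])
      then have "f w = 0" using \<epsilon>(2) w(1) by blast
      then show ?thesis using PE w(2) unfolding h_def complexifies_def by simp
    qed
    moreover have "0 islimpt Z"
      unfolding islimpt_approachable
    proof (intro allI impI)
      fix d :: real assume "d > 0"
      define t where "t = min d (min \<delta>1 \<delta>2) / 2"
      have t: "0 < t" "t < d" "t < min \<delta>1 \<delta>2" using \<open>d > 0\<close> \<delta>1(1) \<delta>2(1) unfolding t_def by auto
      then show "\<exists>x'\<in>Z. x' \<noteq> 0 \<and> dist x' 0 < d"
        unfolding Z_def by (intro bexI[of _ "of_real t"]) auto
    qed
    ultimately have "h 1 = 0"
      using analytic_continuation[OF hol \<open>open T\<close> convex_connected[OF \<open>convex T\<close>] ZT T01(1)] T01(2) by blast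
    moreover have "g (\<psi> 1) = cvec y" using gPhi(1) y O'(2) unfolding \<psi>1 V0_def by auto
    ultimately show "f y = 0" using PE unfolding h_def complexifies_def by simp
  qed
  ultimately show ?thesis by blast
qed

text \<open>The gradients of the defining polynomials are completed to a basis, and linear functions
  supply the missing coordinates. Near \<open>b\<close> the set \<open>X\<close> is then given by
  the vanishing of some of the coordinates.\<close>

lemma zero_propagates_locally:
  fixes X :: "(real^'n) set"
  assumes "nonsingular_at d X b"
  shows "\<exists>V. open V \<and> b \<in> V \<and> (\<forall>f x y \<epsilon>. real_polynomial_function f \<longrightarrow> x \<in> X \<inter> V \<longrightarrow> y \<in> X \<inter> V \<longrightarrow>
    \<epsilon> > 0 \<longrightarrow> (\<forall>z\<in>X. dist z x < \<epsilon> \<longrightarrow> f z = 0) \<longrightarrow> f y = (0::real))"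
proof -
  obtain P U D where P: "finite P" "\<forall>p\<in>P. real_polynomial_function p \<and> (\<forall>y\<in>X. p y = 0)"
    and U: "open U" "b \<in> U" "X \<inter> U = {y\<in>U. \<forall>p\<in>P. p y = 0}"
    and D: "\<forall>p\<in>P. GDERIV p b :> D p" "inj_on D P" "independent (D ` P)"
    using assms unfolding nonsingular_at_def by blast
  obtain B where B: "D ` P \<subseteq> B" "independent B" "UNIV \<subseteq> span B"
    using maximal_independent_subset_extend[OF subset_UNIV D(3)] by metis
  have "card B = CARD('n)"
    using B dim_span[of B] dim_eq_card_independent[OF B(2)] by (simp add: top.extremum_unique)
  then obtain e :: "'n \<Rightarrow> real^'n" where e: "bij_betw e UNIV B"
    using finite_same_card_bij[of "UNIV :: 'n set" B] independent_imp_finite[OF B(2)] by auto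
  define J where "J = {j. e j \<in> D ` P}"
  \<comment> \<open>For \<open>j\<close> outside \<open>J\<close> the linear function has gradient
    \<open>e j\<close> as well, so every \<open>q j\<close> has the prescribed gradient at
    \<open>b\<close>.\<close>
  define q where "q j = (if j \<in> J then the_inv_into P D (e j) else (\<lambda>x. x \<bullet> e j))" for j
  have qJ: "q j \<in> P" "D (q j) = e j" if "j \<in> J" for j
    using that D(2) unfolding q_def J_def by (auto simp: the_inv_into_f_f)
  have qP: "\<exists>j\<in>J. q j = p" if "p \<in> P" for p
  proof -
    have "D p \<in> B" using B(1) that by blast
    then obtain j where j: "e j = D p" using e unfolding bij_betw_def by (metis imageE)
    then have "j \<in> J" using that unfolding J_def by auto
    moreover from this have "q j = p" using qJ[of j] j D(2) that by (auto dest: inj_onD)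
    ultimately show ?thesis by blast
  qed
  show ?thesis
  proof (rule zero_propagates_in_coordinates[where q=q and e=e and J=J and U=U])
    show "real_polynomial_function (q j)" for j
      using P(2) qJ(1)[of j] bounded_linear_inner_left[of "e j"]
      by (cases "j \<in> J") (auto simp: q_def intro: real_polynomial_function.intros)
    show "GDERIV (q j) b :> e j" for j
    proof (cases "j \<in> J")
      case True then show ?thesis using D(1) qJ[of j] by metis
    next
      case False
      then have "q j = (\<lambda>x. x \<bullet> e j)" by (simp add: q_def)
      then show ?thesis unfolding gderiv_def
        by (simp add: bounded_linear_imp_has_derivative bounded_linear_inner_left)
    qed
    show "v = 0" if "\<And>j. v \<bullet> e j = 0" for v
    proof -
      have "v \<bullet> w = 0" if "w \<in> B" for w
        using that e \<open>\<And>j. v \<bullet> e j = 0\<close> unfolding bij_betw_def by (metis imageE)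
      then have "orthogonal v v"
        using B(3) by (intro orthogonal_to_span[of v B]) (auto simp: orthogonal_def)
      then show ?thesis by (simp add: orthogonal_def)
    qed
    show "x \<in> X \<longleftrightarrow> (\<forall>j\<in>J. q j x = 0)" if "x \<in> U" for x
    proof -
      have "x \<in> X \<longleftrightarrow> (\<forall>p\<in>P. p x = 0)" using U(3) that by blast
      also have "\<dots> \<longleftrightarrow> (\<forall>j\<in>J. q j x = 0)" using qJ(1) qP by metis
      finally show ?thesis .
    qed
  qed (rule U(1), rule U(2))
qed

text \<open>What spreads along \<open>X\<close> is vanishing on a whole neighbourhood in
  \<open>X\<close>, not vanishing at a point: this property is locally constant, and connectedness
  carries it from \<open>a\<close> to \<open>y\<close>.\<close>

theorem polynomial_identity:
  fixes X :: "(real^'n) set"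
  assumes X: "smooth_algebraic_set X" "connected X" and f: "real_polynomial_function f"
    and a: "a \<in> X" "\<epsilon> > 0" "\<And>z. z \<in> X \<Longrightarrow> dist z a < \<epsilon> \<Longrightarrow> f z = 0" and y: "y \<in> X"
  shows "f y = 0"
proof -
  define P where "P x \<longleftrightarrow> (\<exists>\<epsilon>>0. \<forall>z\<in>X. dist z x < \<epsilon> \<longrightarrow> f z = 0)" for x
  have "P y"
  proof (rule connected_induction_simple[OF X(2) a(1) y])
    show "P a" using a unfolding P_def by blast
    fix b assume b: "b \<in> X"
    then obtain d where "nonsingular_at d X b" using X(1) unfolding smooth_algebraic_set_def by blast
    from zero_propagates_locally[OF this] obtain V where V: "open V" "b \<in> V"
      "\<And>f x y \<epsilon>. real_polynomial_function f \<Longrightarrow> x \<in> X \<inter> V \<Longrightarrow> y \<in> X \<inter> V \<Longrightarrow> \<epsilon> > 0 \<Longrightarrow>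
         (\<forall>z\<in>X. dist z x < \<epsilon> \<longrightarrow> f z = 0) \<Longrightarrow> f y = (0::real)" by blast
    have "P y'" if "x \<in> X \<inter> V" "y' \<in> X \<inter> V" "P x" for x y'
    proof -
      from that(3) obtain \<epsilon> where \<epsilon>: "\<epsilon> > 0" "\<forall>z\<in>X. dist z x < \<epsilon> \<longrightarrow> f z = 0" unfolding P_def by blast
      have zero: "f z = 0" if "z \<in> X \<inter> V" for z using V(3)[OF f \<open>x \<in> X \<inter> V\<close> that \<epsilon>] .
      obtain \<delta> where "\<delta> > 0" "ball y' \<delta> \<subseteq> V" using V(1) \<open>y' \<in> X \<inter> V\<close> open_contains_ball by blast
      then show ?thesis unfolding P_def using zero by (intro exI[of _ \<delta>]) (auto simp: subset_iff dist_commute)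
    qed
    then have "\<forall>x\<in>X \<inter> V. \<forall>y\<in>X \<inter> V. P x \<longrightarrow> P y" by blast
    moreover have "openin (top_of_set X) (X \<inter> V)" using V(1) by (rule openin_open_Int)
    ultimately show "\<exists>T. openin (top_of_set X) T \<and> b \<in> T \<and> (\<forall>x\<in>T. \<forall>y\<in>T. P x \<longrightarrow> P y)"
      using V(2) b by (intro exI[of _ "X \<inter> V"] conjI) blast+
  qed
  then obtain \<epsilon>' where "\<epsilon>' > 0" "\<forall>z\<in>X. dist z y < \<epsilon>' \<longrightarrow> f z = 0" unfolding P_def by blast
  then have "dist y y < \<epsilon>'" "dist y y < \<epsilon>' \<longrightarrow> f y = 0" using y by (simp, blast)
  then show ?thesis by blast
qed

section \<open>Sets defined by polynomial equations\<close>

text \<open>Separating the variables turns each equation \<open>f (g, x) = 0\<close> into a linear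
  one in the unknowns \<open>b k x\<close>, with coefficients that depend on
  \<open>g\<close>.\<close>

lemma real_polynomial_function_on_Pair:
  assumes "real_polynomial_function (f :: 'a::real_normed_vector \<times> 'b::real_normed_vector \<Rightarrow> real)"
  shows "\<exists>n a b. \<forall>g x. f (g, x) = (\<Sum>k<(n::nat). a k g * b k x)"
proof -
  have "\<exists>ts. \<forall>g x. f (g, x) = (\<Sum>t\<leftarrow>ts. fst t g * snd t x)"
    using assms
  proof induction
    case (linear f)
    have "f (g, x) = (\<Sum>t\<leftarrow>[(\<lambda>g. f (g, 0), \<lambda>x. 1), (\<lambda>g. 1, \<lambda>x. f (0, x))]. fst t g * snd t x)" for g x
      using linear_add[OF bounded_linear.linear[OF linear], of "(g, 0)" "(0, x)"] by simp
    then show ?case by blast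
  next
    case (const c)
    have "c = (\<Sum>t\<leftarrow>[(\<lambda>g::'a. c, \<lambda>x::'b. 1)]. fst t g * snd t x)" for g x by simp
    then show ?case by blast
  next
    case (add f h)
    then obtain ts us where "\<forall>g x. f (g, x) = (\<Sum>t\<leftarrow>ts. fst t g * snd t x)"
      "\<forall>g x. h (g, x) = (\<Sum>t\<leftarrow>us. fst t g * snd t x)" by blast
    then have "\<forall>g x. f (g, x) + h (g, x) = (\<Sum>t\<leftarrow>ts @ us. fst t g * snd t x)" by simp
    then show ?case by blast
  next
    case (mult f h)
    then obtain ts us where *: "\<forall>g x. f (g, x) = (\<Sum>t\<leftarrow>ts. fst t g * snd t x)"
      "\<forall>g x. h (g, x) = (\<Sum>t\<leftarrow>us. fst t g * snd t x)" by blast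
    define prd where "prd t = map (\<lambda>u. (\<lambda>g. fst t g * fst u g, \<lambda>x. snd t x * snd u x)) us"
      for t :: "('a \<Rightarrow> real) \<times> ('b \<Rightarrow> real)"
    have prd: "(\<Sum>u\<leftarrow>prd t. fst u g * snd u x) = fst t g * snd t x * (\<Sum>u\<leftarrow>us. fst u g * snd u x)" for t g x
      by (simp add: prd_def o_def sum_list_const_mult[symmetric] mult_ac)
    have "(\<Sum>t\<leftarrow>ts. fst t g * snd t x) * (\<Sum>u\<leftarrow>us. fst u g * snd u x)
        = (\<Sum>t\<leftarrow>concat (map prd ts). fst t g * snd t x)" for g x
      by (induction ts) (simp_all add: prd distrib_right)
    then have "\<forall>g x. f (g, x) * h (g, x) = (\<Sum>t\<leftarrow>concat (map prd ts). fst t g * snd t x)"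
      using * by simp
    then show ?case by blast
  qed
  then obtain ts where "\<forall>g x. f (g, x) = (\<Sum>t\<leftarrow>ts. fst t g * snd t x)" by blast
  then have "\<forall>g x. f (g, x) = (\<Sum>k<length ts. fst (ts ! k) g * snd (ts ! k) x)"
    by (simp add: sum_list_sum_nth atLeast0LessThan)
  then show ?thesis
    by (intro exI[of _ "length ts"] exI[of _ "\<lambda>k. fst (ts ! k)"] exI[of _ "\<lambda>k. snd (ts ! k)"])
qed

text \<open>Gaussian elimination by induction on the number of unknowns: an equation with nonzero
  last coefficient, that of \<open>g0\<close>, is the pivot for all others, and \<open>a'\<close>
  are the coefficients after elimination. Each unknown adds at most one equation to
  \<open>H\<close>.\<close>

lemma finite_system_suffices:
  fixes a :: "nat \<Rightarrow> 'g \<Rightarrow> real"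
  shows "\<exists>H\<subseteq>G. finite H \<and>
     (\<forall>\<beta>. (\<forall>h\<in>H. (\<Sum>k<n. a k h * \<beta> k) = 0) \<longrightarrow> (\<forall>g\<in>G. (\<Sum>k<n. a k g * \<beta> k) = 0))"
proof (induction n arbitrary: a)
  case 0 show ?case by (rule exI[of _ "{}"]) simp
next
  case (Suc n)
  show ?case
  proof (cases "\<forall>g\<in>G. a n g = 0")
    case True
    from Suc[of a] obtain H where H: "H \<subseteq> G" "finite H"
      "\<forall>\<beta>. (\<forall>h\<in>H. (\<Sum>k<n. a k h * \<beta> k) = 0) \<longrightarrow> (\<forall>g\<in>G. (\<Sum>k<n. a k g * \<beta> k) = 0)" by blast
    have "(\<Sum>k<Suc n. a k g * \<beta> k) = (\<Sum>k<n. a k g * \<beta> k)" if "g \<in> G" for g \<beta> using True that by simp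
    with H show ?thesis by (intro exI[of _ H]) (metis subsetD)
  next
    case False
    then obtain g0 where g0: "g0 \<in> G" "a n g0 \<noteq> 0" by blast
    define a' where "a' k g = a k g - a n g * (a k g0 / a n g0)" for k g
    from Suc[of a'] obtain H where H: "H \<subseteq> G" "finite H"
      "\<forall>\<beta>. (\<forall>h\<in>H. (\<Sum>k<n. a' k h * \<beta> k) = 0) \<longrightarrow> (\<forall>g\<in>G. (\<Sum>k<n. a' k g * \<beta> k) = 0)" by blast
    have eq: "(\<Sum>k<Suc n. a k g * \<beta> k) = (\<Sum>k<n. a' k g * \<beta> k)"
      if "(\<Sum>k<Suc n. a k g0 * \<beta> k) = 0" for g \<beta>
    proof -
      have "\<beta> n = - (\<Sum>k<n. a k g0 * \<beta> k) / a n g0"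
        using that g0(2) by (simp add: field_simps)
      then have "(\<Sum>k<Suc n. a k g * \<beta> k)
          = (\<Sum>k<n. a k g * \<beta> k) - a n g * ((\<Sum>k<n. a k g0 * \<beta> k) / a n g0)" by simp
      also have "\<dots> = (\<Sum>k<n. a' k g * \<beta> k)"
        by (simp add: a'_def left_diff_distrib sum_subtractf sum_distrib_left sum_divide_distrib mult.assoc)
      finally show ?thesis .
    qed
    show ?thesis
    proof (rule exI[of _ "insert g0 H"], intro conjI allI impI)
      fix \<beta> assume z: "\<forall>h\<in>insert g0 H. (\<Sum>k<Suc n. a k h * \<beta> k) = 0"
      then have "(\<Sum>k<Suc n. a k g0 * \<beta> k) = 0" by blast
      note e = eq[OF this]
      have "\<forall>h\<in>H. (\<Sum>k<n. a' k h * \<beta> k) = 0" using z e by (metis insertCI)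
      then have "\<forall>g\<in>G. (\<Sum>k<n. a' k g * \<beta> k) = 0" using H(3) by blast
      then show "\<forall>g\<in>G. (\<Sum>k<Suc n. a k g * \<beta> k) = 0" using e by simp
    qed (use H g0 in auto)
  qed
qed

lemma polynomial_function_Pair_const:
  "polynomial_function (\<lambda>x :: 'b::real_normed_vector. (h :: 'a::real_normed_vector, x))"
  unfolding polynomial_function_def o_def
proof (intro allI impI)
  fix l :: "'a \<times> 'b \<Rightarrow> real" assume l: "bounded_linear l"
  have "l (h, x) = l (h, 0) + l (0, x)" for x
    using linear_add[OF bounded_linear.linear[OF l], of "(h, 0)" "(0, x)"] by simp
  then have eq: "(\<lambda>x. l (h, x)) = (\<lambda>x. l (h, 0) + l (0, x))" by (rule ext)
  have "bounded_linear (\<lambda>x. l (0, x))"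
    by (intro bounded_linear_compose[OF l] bounded_linear_Pair bounded_linear_ident bounded_linear_zero)
  then show "real_polynomial_function (\<lambda>x. l (h, x))"
    by (subst eq) (intro real_polynomial_function.intros)
qed

lemma algebraic_set_finite_intersection:
  assumes "algebraic_set X" "finite Q" "\<And>q. q \<in> Q \<Longrightarrow> real_polynomial_function q"
  shows "algebraic_set {x \<in> X. \<forall>q\<in>Q. q x = 0}"
proof -
  from assms(1) obtain P where "finite P" "\<forall>p\<in>P. real_polynomial_function p" "X = {x. \<forall>p\<in>P. p x = 0}"
    unfolding algebraic_set_def by blast
  with assms(2,3) show ?thesis
    unfolding algebraic_set_def by (intro exI[of _ "P \<union> Q"]) auto
qed

text \<open>There is a vector equation for each \<open>g\<close>, whereas
  \<open>algebraic_set\<close> admits finitely many; in each coordinate a finite subset of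
  \<open>G\<close> already implies all of them.\<close>

lemma algebraic_set_fixed_equations:
  fixes X :: "(real^'n) set" and F :: "'a::real_normed_vector \<times> (real^'n) \<Rightarrow> real^'n"
  assumes X: "algebraic_set X" and F: "polynomial_function F"
  shows "algebraic_set {x \<in> X. \<forall>g\<in>G. F (g, x) = x}"
proof -
  define f where "f i z = F z $ i - snd z $ i" for i z
  have f: "real_polynomial_function (f i)" for i
  proof -
    have "real_polynomial_function (\<lambda>z. F z $ i)"
      using F bounded_linear_vec_nth[of i] unfolding polynomial_function_def o_def by blast
    moreover have "bounded_linear (\<lambda>z :: 'a \<times> (real^'n). snd z $ i)"
      by (intro bounded_linear_compose[OF bounded_linear_vec_nth] bounded_linear_snd)
    ultimately show ?thesis
      unfolding f_def by (intro real_polynomial_function_diff) (auto intro: real_polynomial_function.intros)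
  qed
  have "\<exists>H\<subseteq>G. finite H \<and> (\<forall>x. (\<forall>h\<in>H. f i (h, x) = 0) \<longrightarrow> (\<forall>g\<in>G. f i (g, x) = 0))" for i
  proof -
    obtain n a b where ab: "\<And>g x. f i (g, x) = (\<Sum>k<(n::nat). a k g * b k x)"
      using real_polynomial_function_on_Pair[OF f[of i]] by blast
    from finite_system_suffices[where G=G and n=n and a=a] obtain H where H: "H \<subseteq> G" "finite H"
      "\<forall>\<beta>. (\<forall>h\<in>H. (\<Sum>k<n. a k h * \<beta> k) = 0) \<longrightarrow> (\<forall>g\<in>G. (\<Sum>k<n. a k g * \<beta> k) = 0)" by blast
    have "(\<forall>h\<in>H. f i (h, x) = 0) \<longrightarrow> (\<forall>g\<in>G. f i (g, x) = 0)" for x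
      unfolding ab by (rule H(3)[THEN spec[of _ "\<lambda>k. b k x"]])
    with H(1,2) show ?thesis by blast
  qed
  then obtain H where H: "\<And>i. H i \<subseteq> G" "\<And>i. finite (H i)"
    "\<And>i x. (\<forall>h\<in>H i. f i (h, x) = 0) \<Longrightarrow> (\<forall>g\<in>G. f i (g, x) = 0)" by metis
  define Q where "Q = (\<Union>i. (\<lambda>h x. f i (h, x)) ` H i)"
  have "finite Q" using H(2) by (simp add: Q_def)
  moreover have "real_polynomial_function q" if q: "q \<in> Q" for q
  proof -
    from q obtain i h where "q = f i \<circ> (\<lambda>x. (h, x))" unfolding Q_def by (auto simp: o_def)
    then show ?thesis
      using real_polynomial_function_compose[OF polynomial_function_Pair_const f] by simp
  qed
  ultimately have alg: "algebraic_set {x \<in> X. \<forall>q\<in>Q. q x = 0}" by (rule algebraic_set_finite_intersection[OF X])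
  have "(\<forall>q\<in>Q. q x = 0) \<longleftrightarrow> (\<forall>g\<in>G. F (g, x) = x)" for x
  proof -
    have "(\<forall>q\<in>Q. q x = 0) \<longleftrightarrow> (\<forall>i. \<forall>h\<in>H i. f i (h, x) = 0)" unfolding Q_def by auto
    also have "\<dots> \<longleftrightarrow> (\<forall>i. \<forall>g\<in>G. f i (g, x) = 0)" using H(1,3) by blast
    also have "\<dots> \<longleftrightarrow> (\<forall>g\<in>G. F (g, x) = x)" by (auto simp: f_def vec_eq_iff)
    finally show ?thesis .
  qed
  with alg show ?thesis by simp
qed

lemma algebraic_imp_closed:
  assumes "algebraic_set (X :: 'a::euclidean_space set)" shows "closed X"
proof -
  from assms obtain P where P: "\<forall>p\<in>P. real_polynomial_function p" "X = {x. \<forall>p\<in>P. p x = 0}"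
    unfolding algebraic_set_def by blast
  have "closed {x. p x = 0}" if "p \<in> P" for p
    using P(1) that continuous_on_polymonial_function[of p UNIV] real_polynomial_function_eq[of p]
    by (intro closed_Collect_eq) auto
  moreover have "X = (\<Inter>p\<in>P. {x. p x = 0})" unfolding P(2) by blast
  ultimately show ?thesis by (simp add: closed_INT)
qed

lemma algebraic_imp_semialgebraic:
  assumes "algebraic_set X" shows "semialgebraic X"
proof -
  from assms obtain P where P: "finite P" "\<forall>p\<in>P. real_polynomial_function p" "X = {x. \<forall>p\<in>P. p x = 0}"
    unfolding algebraic_set_def by blast
  have "semialgebraic {x. \<forall>p\<in>P. p x = 0}"
    using P(1,2)
  proof (induction P)
    case empty
    have "semialgebraic {x :: 'a. (\<lambda>_. 1) x > (0::real)}"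
      by (rule semialgebraic.pos) (rule real_polynomial_function.intros)
    then show ?case by simp
  next
    case (insert p P)
    have p: "real_polynomial_function p" using insert.prems by blast
    have "{x. \<forall>p\<in>insert p P. p x = 0} = (- {x. p x > 0} \<inter> - {x. - p x > 0}) \<inter> {x. \<forall>p\<in>P. p x = 0}"
      by (auto simp: less_eq_real_def)
    moreover have "semialgebraic \<dots>"
      using insert p real_polynomial_function_minus[OF p]
      by (intro semialgebraic.inter semialgebraic.compl semialgebraic.pos) auto
    ultimately show ?case by simp
  qed
  with P(3) show ?thesis by simp
qed

section \<open>Uniruledness of the fixed point set\<close>

lemma invertible_mat_1: "invertible (mat 1 :: real^'m^'m)"
  unfolding invertible_def by (intro exI[of _ "mat 1"]) simp

lemma group_general_linear_group: "group (general_linear_group :: (real^'m^'m) monoid)"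
proof (rule groupI)
  fix A :: "real^'m^'m" assume "A \<in> carrier general_linear_group"
  then obtain A' where "A ** A' = mat 1" "A' ** A = mat 1"
    by (auto simp: general_linear_group_def invertible_def)
  then show "\<exists>B\<in>carrier general_linear_group. B \<otimes>\<^bsub>general_linear_group\<^esub> A = \<one>\<^bsub>general_linear_group\<^esub>"
    by (auto simp: general_linear_group_def invertible_def)
qed (auto simp: general_linear_group_def invertible_mult invertible_mat_1 matrix_mul_assoc)

lemma subgroup_general_linear_inverse:
  assumes "subgroup G general_linear_group" "g \<in> G"
  shows "\<exists>h\<in>G. g ** h = mat 1 \<and> h ** g = mat 1"
proof -
  interpret GL: group "general_linear_group :: (real^'m^'m) monoid"
    by (rule group_general_linear_group)
  have g: "g \<in> carrier general_linear_group" using subgroup.subset[OF assms(1)] assms(2) by blast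
  show ?thesis
    using subgroup.m_inv_closed[OF assms] GL.r_inv[OF g] GL.l_inv[OF g]
    by (intro bexI) (auto simp: general_linear_group_def)
qed

lemma poly_map_of_coefficients:
  "\<exists>p. (\<forall>i. degree (p $ i) \<le> d) \<and> poly_map p = (\<lambda>u. \<Sum>k\<le>d. u ^ k *\<^sub>R l k)"
proof -
  define p where "p = (\<chi> i. \<Sum>k\<le>d. monom (l k $ i) k)"
  have "degree (p $ i) \<le> d" for i
    unfolding p_def vec_lambda_beta
    by (intro degree_sum_le) (auto intro: order.trans[OF degree_monom_le])
  moreover have "poly_map p u = (\<Sum>k\<le>d. u ^ k *\<^sub>R l k)" for u
    by (simp add: poly_map_def p_def vec_eq_iff poly_sum poly_monom mult.commute)
  ultimately show ?thesis by blast
qed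

theorem corollary5p3:
  fixes G :: "(real^'m^'m) set"
    and X :: "(real^'n) set"
    and \<phi> :: "real^'m^'m \<Rightarrow> real^'n \<Rightarrow> real^'n"
  assumes "unipotent_group G"
    and "G \<noteq> {mat 1}"
    and "connected G"
    and "smooth_algebraic_set X"
    and "connected X"
    and "polynomial_action G X \<phi>"
    and "faithful_action (general_linear_group\<lparr>carrier := G\<rparr>) X \<phi>"
  shows "R_uniruled (fixed_points G X \<phi>)"
proof -
  have sub: "subgroup G general_linear_group"
    and alg: "\<exists>V. algebraic_set V \<and> G = V \<inter> {A. invertible A}"
    and unip: "\<And>A. A \<in> G \<Longrightarrow> unipotent_matrix A"
    using assms(1) unfolding unipotent_group_def linear_algebraic_group_def general_linear_group_def
    by auto
  have algX: "algebraic_set X" using assms(4) unfolding smooth_algebraic_set_def by blast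
  obtain F where F: "polynomial_function F" "\<And>g x. g \<in> G \<Longrightarrow> x \<in> X \<Longrightarrow> \<phi> g x = F (g, x)"
    using assms(6) unfolding polynomial_action_def by blast
  interpret act: faithful_action "general_linear_group\<lparr>carrier := G\<rparr>" X \<phi> by (rule assms(7))
  have id: "\<phi> (mat 1) = (\<lambda>x\<in>X. x)"
    using act.id_eq_one by (simp add: general_linear_group_def)
  have oneG: "mat 1 \<in> G" using subgroup.one_closed[OF sub] by (simp add: general_linear_group_def)
  interpret unipotent_action G X \<phi> F
  proof unfold_locales
    show "g ** h \<in> G" if "g \<in> G" "h \<in> G" for g h
      using subgroup.m_closed[OF sub that] by (simp add: general_linear_group_def)
    show "\<phi> (g ** h) x = \<phi> g (\<phi> h x)" if "g \<in> G" "h \<in> G" "x \<in> X" for g h x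
      using act.composition_rule[of x g h] that by (simp add: general_linear_group_def)
    show "\<phi> g x \<in> X" if "g \<in> G" "x \<in> X" for g x
      using act.element_image[of g x] that by simp
  qed (use oneG subgroup_general_linear_inverse[OF sub] unip alg algebraic_imp_closed[OF algX] id F
    in \<open>simp_all\<close>)
  have fix_eq: "fixed_points G X \<phi> = {x \<in> X. \<forall>g\<in>G. F (g, x) = x}"
    unfolding fixed_points_def using F(2) by auto
  have alg_fix: "algebraic_set (fixed_points G X \<phi>)"
    unfolding fix_eq by (rule algebraic_set_fixed_equations[OF algX F(1)])
  \<comment> \<open>If all points near \<open>a\<close> were fixed, every \<open>g\<close> would act
    trivially on \<open>X\<close>, and faithfulness would force \<open>G\<close> to be
    trivial.\<close>
  have acc: "\<exists>x\<in>X. dist x a < \<delta> \<and> x \<notin> fixed_points G X \<phi>"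
    if a: "a \<in> fixed_points G X \<phi>" and "\<delta> > 0" for a \<delta>
  proof (rule ccontr)
    assume "\<not> ?thesis"
    then have near: "F (g, x) = x" if "x \<in> X" "dist x a < \<delta>" "g \<in> G" for x g
      using that unfolding fix_eq by blast
    have aX: "a \<in> X" using a unfolding fix_eq by blast
    have "F (g, x) $ i - x $ i = 0" if g: "g \<in> G" and x: "x \<in> X" for g x i
    proof (rule polynomial_identity[OF assms(4,5) _ aX \<open>\<delta> > 0\<close> _ x])
      have "real_polynomial_function (\<lambda>z. F z $ i)"
        using F(1) bounded_linear_vec_nth[of i] unfolding polynomial_function_def o_def by blast
      from real_polynomial_function_compose[OF polynomial_function_Pair_const this]
      have "real_polynomial_function ((\<lambda>z. F z $ i) \<circ> (\<lambda>x. (g, x)))" .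
      then show "real_polynomial_function (\<lambda>x. F (g, x) $ i - x $ i)"
        unfolding o_def
        by (rule real_polynomial_function_diff)
           (rule real_polynomial_function.intros, rule bounded_linear_vec_nth)
    qed (use near g in simp)
    then have fixed: "\<phi> g x = x" if "g \<in> G" "x \<in> X" for g x
      using that F(2) by (simp add: vec_eq_iff)
    have "g = mat 1" if g: "g \<in> G" for g
    proof -
      \<comment> \<open>Faithfulness is injectivity into functions on the whole space. Both maps are
        \<open>undefined\<close> outside \<open>X\<close>, so agreement on \<open>X\<close> is
        equality.\<close>
      have "\<phi> g \<in> extensional X" using act.bij_prop0[of g] g by (simp add: Bij_def)
      then have "\<phi> g = \<phi> (mat 1)"
        unfolding id using fixed[OF g] by (auto simp: extensional_def restrict_def)
      then show ?thesis using act.faithful g oneG by (auto dest: inj_onD)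
    qed
    with oneG assms(2) show False by blast
  qed
  obtain d where d: "\<And>a. a \<in> fixed_points G X \<phi> \<Longrightarrow>
      \<exists>l. (\<Sum>k\<le>d. 0 ^ k *\<^sub>R l k) = a \<and> (\<Sum>k\<le>d. 1 ^ k *\<^sub>R l k) \<noteq> a \<and>
        (\<forall>u. (\<Sum>k\<le>d. u ^ k *\<^sub>R l k) \<in> fixed_points G X \<phi>)"
    using curve_of_fixed_points acc by (elim exE) blast
  have "\<exists>C. polynomially_parametric_curve d (fixed_points G X \<phi>) C \<and> a \<in> C"
    if a: "a \<in> fixed_points G X \<phi>" for a
  proof -
    from d[OF a] obtain l where l: "(\<Sum>k\<le>d. 0 ^ k *\<^sub>R l k) = a" "(\<Sum>k\<le>d. 1 ^ k *\<^sub>R l k) \<noteq> a"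
      "\<And>u. (\<Sum>k\<le>d. u ^ k *\<^sub>R l k) \<in> fixed_points G X \<phi>" by blast
    from poly_map_of_coefficients[of d l] obtain p where p: "\<forall>i. degree (p $ i) \<le> d"
      "poly_map p = (\<lambda>u. \<Sum>k\<le>d. u ^ k *\<^sub>R l k)" by blast
    have p01: "poly_map p 0 = a" "poly_map p 1 \<noteq> a" using l(1,2) unfolding p(2) by blast+
    have "\<not> poly_map p constant_on UNIV"
    proof
      assume "poly_map p constant_on UNIV"
      then obtain c where "\<And>u. poly_map p u = c" unfolding constant_on_def by blast
      with p01 show False by metis
    qed
    moreover have "range (poly_map p) \<subseteq> fixed_points G X \<phi>" unfolding p(2) using l(3) by blast
    moreover have "a \<in> range (poly_map p)" using p01(1) by blast
    ultimately show ?thesis unfolding polynomially_parametric_curve_def using p(1) by blast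
  qed
  then show ?thesis
    unfolding R_uniruled_def R_uniruled_of_degree_le_def
    using algebraic_imp_closed[OF alg_fix] algebraic_imp_semialgebraic[OF alg_fix] by blast
qed

end
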